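(* Let $1\le k< d\wedge n$. Let $S$ be the random $d\times k$ column-sampling matrix $S=[e_{i_1}\ \cdots\ e_{i_k}]$, where $i_1,\ldots,i_k$ are drawn uniformly at random without replacement from $\{1,\ldots,d\}$ and $e_1,\dots,e_d$ are the canonical basis vectors of $\mathbb{R}^d$, and let $R$ be a $d\times k$ random matrix with i.i.d. $N(0,1/k)$ entries. (i) If $n\ge d$ and $X \in \mathbb{R}^{n \times d}$ has flat spectrum, i.e. its singular values satisfy $\sigma_1=\cdots=\sigma_d=\sqrt n$, then $$\mathbf{E}[\mathcal{E}(R)] = \mathbf{E}[\mathcal{E}(S)] = \left(1-\frac kd\right)\|\alpha^*\|_2^2+\frac kn\sigma^2 .$$ (ii) If $n<d$, there exists an $X\in\mathbb{R}^{n\times d}$ with flat spectrum, i.e. $\sigma_1=\cdots=\sigma_n=\sqrt d$, such that $$\mathbf{E}[\mathcal{E}(R)] = \|\alpha^*\|_2^2\,\frac dn\left(1-\frac kn\right)+\frac kn\sigma^2 \;<\; \mathbf{E}[\mathcal{E}(S)] = \|\alpha^*\|_2^2\,\frac dn\left(1-\frac kd\right)+\frac kn\sigma^2 .$$ (iii) If $X$ is a random $n\times d$ matrix with i.i.d. $N(0,1)$ entries, then $\mathbf{E}[\mathcal{E}(R)]=\mathbf{E}[\mathcal{E}(S)]$, where the expectations are with respect to the randomness of both $X$ and $R$, respectively $X$ and $S$.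
   Context: $n,d$ are positive integers and $d \wedge n = \min\{d,n\}$. Model: $y=f+\xi\in\mathbb{R}^n$ with $f=\mathbf{E}[y]\in\mathbb{R}^n$ deterministic and $\xi$ having uncorrelated entries with mean zero and variance $\sigma^2$; the random matrices $R$, $S$ (and $X$ in (iii)) are independent of $\xi$, and in (iii) $X$ is independent of $R$ and $S$. For a matrix $M$, $P_M$ denotes the orthogonal projection onto the column space of $M$. For a design matrix $X\in\mathbb{R}^{n\times d}$ of full rank $d\wedge n$ with singular value decomposition $X=U\Sigma V^\top$ ($U\in\mathbb{R}^{n\times (d\wedge n)}$, $V\in\mathbb{R}^{d\times (d\wedge n)}$ with orthonormal columns, $\Sigma$ diagonal with the singular values $\sigma_1\ge\cdots\ge\sigma_{d\wedge n}$), $w^*\in\mathbb{R}^d$ is the vector of minimum $\ell_2$-norm satisfying $Xw^*=P_Xf$, and $\alpha^*=V^\top w^*\in\mathbb{R}^{d\wedge n}$. Excess risk: for a $d\times k$ matrix $R$, $\mathcal{E}(R)=\mathbf{E}_\xi\big[\|Xw^*-XR\,\widehat w_R\|_2^2/n\big]$, where $\widehat w_R$ is a least squares solution for response $y$ and design $XR$, i.e. $XR\,\widehat w_R=P_{XR}\,y$, the expectation being over $\xi$ only. Equivalently $\mathcal{E}(R)=\|(I-P_{XR})Xw^*\|_2^2/n+\sigma^2\,\mathrm{rank}(XR)/n$. In (i) and (ii), $\mathbf{E}[\mathcal{E}(R)]$ and $\mathbf{E}[\mathcal{E}(S)]$ denote expectations over $R$ and $S$, respectively.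
   Formalization: In (ii) the strict inequality is claimed only for f ≠ 0 (for f = 0 one has α* = 0 and both sides equal kσ²/n), and the matrix X is allowed to depend on the fixed vector f. *)

theory Defs
  imports "HOL-Probability.Probability"
begin

definition col_proj :: "real^'c^'n \<Rightarrow> real^'n \<Rightarrow> real^'n" where
  "col_proj A y = (THE p. p \<in> span (columns A) \<and> (\<forall>v \<in> span (columns A). orthogonal (y - p) v))"

definition w_star :: "real^'d^'n \<Rightarrow> real^'n \<Rightarrow> real^'d" where
  "w_star X f = arg_min norm (\<lambda>w. X *v w = col_proj X f)"

text \<open>The least squares solution need not be unique; the choice made by \<^const>\<open>arg_min\<close> does not
  affect the fitted vector \<open>A *v least_squares A y\<close>.\<close>

definition least_squares :: "real^'c^'n \<Rightarrow> real^'n \<Rightarrow> real^'c" where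
  "least_squares A y = arg_min (\<lambda>w. (norm (y - A *v w))\<^sup>2) (\<lambda>_. True)"

text \<open>Thin singular value decomposition \<open>X = U diag(s) V\<^sup>T\<close>. It is meant to be used at an index type
  \<open>'r\<close> with \<open>CARD('r) = min CARD('d) CARD('n)\<close>; the linear order on \<open>'r\<close> only serves to list the
  singular values in decreasing order.\<close>

definition thin_svd ::
  "real^'d^'n \<Rightarrow> real^('r::{finite,linorder})^'n \<Rightarrow> real^('r::{finite,linorder}) \<Rightarrow>
   real^('r::{finite,linorder})^'d \<Rightarrow> bool" where
  "thin_svd X U s V \<longleftrightarrow>
     transpose U ** U = mat 1 \<and> transpose V ** V = mat 1 \<and>
     (\<forall>i. 0 \<le> s $ i) \<and> (\<forall>i j. i \<le> j \<longrightarrow> s $ j \<le> s $ i) \<and>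
     X = U ** (\<chi> i j. if i = j then s $ i else 0) ** transpose V"

definition alpha_star :: "real^'r^'d \<Rightarrow> real^'d^'n \<Rightarrow> real^'n \<Rightarrow> real^'r" where
  "alpha_star V X f = transpose V *v w_star X f"

definition white_noise :: "'w measure \<Rightarrow> real \<Rightarrow> ('w \<Rightarrow> real^'n) \<Rightarrow> bool" where
  "white_noise M \<sigma> \<xi> \<longleftrightarrow>
     \<xi> \<in> borel_measurable M \<and>
     (\<forall>i. integrable M (\<lambda>\<omega>. (\<xi> \<omega> $ i)\<^sup>2)) \<and>
     (\<forall>i. (LINT \<omega>|M. \<xi> \<omega> $ i) = 0) \<and>
     (\<forall>i. (LINT \<omega>|M. (\<xi> \<omega> $ i)\<^sup>2) = \<sigma>\<^sup>2) \<and>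
     (\<forall>i j. i \<noteq> j \<longrightarrow> (LINT \<omega>|M. \<xi> \<omega> $ i * \<xi> \<omega> $ j) = 0)"

text \<open>The expectation is over the noise \<open>\<xi>\<close> only: \<open>X\<close> and \<open>R\<close> are deterministic arguments here.\<close>

definition excess_risk ::
  "'w measure \<Rightarrow> ('w \<Rightarrow> real^'n) \<Rightarrow> real^'n \<Rightarrow> real^'d^'n \<Rightarrow> real^'k^'d \<Rightarrow> real" where
  "excess_risk M \<xi> f X R =
     (LINT \<omega>|M. (norm (X *v w_star X f - (X ** R) *v least_squares (X ** R) (f + \<xi> \<omega>)))\<^sup>2
                  / real CARD('n))"

text \<open>Independent entries with distribution \<open>N(0, v)\<close>; \<^const>\<open>normal_density\<close> takes the standard
  deviation.\<close>

definition iid_normal_matrix :: "'w measure \<Rightarrow> real \<Rightarrow> ('w \<Rightarrow> real^'c^'r) \<Rightarrow> bool" where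
  "iid_normal_matrix M v A \<longleftrightarrow>
     prob_space.indep_vars M (\<lambda>_. borel) (\<lambda>(i, j) \<omega>. A \<omega> $ i $ j) UNIV \<and>
     (\<forall>i j. distributed M lborel (\<lambda>\<omega>. A \<omega> $ i $ j) (normal_density 0 (sqrt v)))"

text \<open>Column \<open>j\<close> is the canonical basis vector with index \<open>\<iota> j\<close>.\<close>

definition sampling_matrix :: "('k \<Rightarrow> 'd) \<Rightarrow> real^'k^'d" where
  "sampling_matrix \<iota> = (\<chi> i j. if i = \<iota> j then 1 else 0)"

text \<open>Drawing an ordered sample uniformly without replacement means that the index map is uniformly
  distributed on the injective maps.\<close>

definition uniform_column_sampling :: "'w measure \<Rightarrow> ('w \<Rightarrow> real^'k^'d) \<Rightarrow> bool" where
  "uniform_column_sampling M S \<longleftrightarrow>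
     (\<exists>\<iota> :: 'w \<Rightarrow> 'k \<Rightarrow> 'd.
        \<iota> \<in> measurable M (count_space UNIV) \<and>
        distr M (count_space UNIV) \<iota> = measure_pmf (pmf_of_set {h. inj h}) \<and>
        (\<forall>\<omega> \<in> space M. S \<omega> = sampling_matrix (\<iota> \<omega>)))"

text \<open>The library's \<open>indep_var\<close> requires both random variables to have the same type, hence this
  version via the generated sigma-algebras.\<close>

definition indep_rv ::
  "'w measure \<Rightarrow> ('w \<Rightarrow> 'a::topological_space) \<Rightarrow> ('w \<Rightarrow> 'b::topological_space) \<Rightarrow> bool" where
  "indep_rv M A B \<longleftrightarrow>
     A \<in> borel_measurable M \<and> B \<in> borel_measurable M \<and>
     prob_space.indep_set M (sets (vimage_algebra (space M) A borel))
                            (sets (vimage_algebra (space M) B borel))"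

end

theory Submission
  imports Defs
begin

text \<open>By Pythagoras and uncorrelated noise, the excess risk of a sketch \<open>B\<close> is
  \<open>(|P_X f|^2 - |P_XB f|^2 + \<sigma>^2 rank (XB)) / n\<close>, so the claims reduce to \<open>E |P_XB f|^2\<close> for
  matrices \<open>XB\<close> of full column rank almost surely. If the law of an \<open>m \<times> k\<close> matrix \<open>A\<close> is invariant
  under rotations from the left, then \<open>E |P_A u|^2\<close> depends on \<open>|u|\<close> only; summing over a basis gives
  \<open>m E |P_A u|^2 = k |u|^2\<close>. This applies to \<open>V\<^sup>T R\<close> in (i) and (ii), and to both \<open>X R\<close> and \<open>X S\<close>
  in (iii), conditionally on \<open>R\<close> or \<open>S\<close>. For \<open>S\<close> in (i), \<open>P_S\<close> is a coordinate projection.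

  In (ii), \<open>X = \<surd>d U V\<^sup>T\<close> depends on \<open>f\<close>: one column of \<open>X\<close> is parallel to \<open>f\<close> and orthogonal to all other
  columns, so that \<open>f\<close> is recovered exactly when this column is sampled and not at all otherwise. The
  remaining columns are in general position, so that \<open>X S\<close> always has rank \<open>k\<close>.\<close>

subsection \<open>Projections and the excess risk\<close>

text \<open>The trace identity also holds for sampling: if V^T S has rank k, then averaging |P u|^2
  over an orthonormal basis of directions u in R^n gives k/n, as for the Gaussian sketch. Hence S
  can fall behind R in (ii) only along particular directions, and f is placed on one that survives
  with probability k/d < k/n. The other columns of X then live in n-1 dimensions, and any k of them
  must still be independent; this is where k < n enters. Two facts carry the analysis. A Gaussian
  matrix has a density that is radial in the Frobenius norm, so its rotation invariance comes down
  to that of Lebesgue measure. And a linear family of matrices is injective almost everywhere as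
  soon as it has one injective member; this yields the almost sure ranks of the Gaussian sketches as
  well as the deterministic design of (ii), so that each rank claim only asks for one explicit
  witness.\<close>

lemma span_columns_eq_range: "span (columns A) = range ((*v) (A :: real^'c^'n))"
proof
  show "range ((*v) A) \<subseteq> span (columns A)"
    unfolding matrix_mult_sum scalar_mult_eq_scaleR
    by (intro image_subsetI span_sum span_scale span_base) (auto simp: columns_def)
  have "columns A \<subseteq> range ((*v) A)"
    by (auto simp: columns_def image_iff intro: matrix_vector_mult_basis[symmetric])
  moreover have "subspace (range ((*v) A))"
    by (intro linear_subspace_image) (auto simp: matrix_vector_mul_linear)
  ultimately show "span (columns A) \<subseteq> range ((*v) A)"
    by (rule span_minimal)
qed

text \<open>The difference of two candidates lies in the range and is orthogonal to it, hence
  vanishes. This settles the \<open>THE\<close> in \<open>col_proj\<close>, and later projections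
  are computed through this criterion.\<close>

lemma col_proj_eqI:
  assumes "p \<in> range ((*v) A)" and "\<And>w. (y - p) \<bullet> (A *v w) = 0"
  shows "col_proj A y = p"
  unfolding col_proj_def span_columns_eq_range
proof (rule the_equality)
  show "p \<in> range ((*v) A) \<and> (\<forall>v\<in>range ((*v) A). orthogonal (y - p) v)"
    using assms by (auto simp: orthogonal_def)
next
  fix q assume q: "q \<in> range ((*v) A) \<and> (\<forall>v\<in>range ((*v) A). orthogonal (y - q) v)"
  obtain a b where ab: "p = A *v a" "q = A *v b" using assms(1) q by blast
  have "(y - p) \<bullet> (A *v (a - b)) = 0" "(y - q) \<bullet> (A *v (a - b)) = 0"
    using assms(2) q by (auto simp: orthogonal_def)
  then have "(q - p) \<bullet> (p - q) = 0"
    by (simp add: ab matrix_vector_mult_diff_distrib inner_diff_left)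
  then have "(p - q) \<bullet> (p - q) = 0"
    by (simp add: inner_diff inner_commute)
  then show "q = p" by simp
qed

lemma
  shows col_proj_in_range: "col_proj A y \<in> range ((*v) A)"
    and col_proj_orthogonal: "(y - col_proj A y) \<bullet> (A *v w) = 0"
proof -
  obtain p z where "p \<in> span (range ((*v) A))"
    "\<And>v. v \<in> span (range ((*v) A)) \<Longrightarrow> orthogonal z v" "y = p + z"
    using orthogonal_subspace_decomp_exists by blast
  then have p: "p \<in> range ((*v) A)" "\<And>w. (y - p) \<bullet> (A *v w) = 0"
    unfolding span_columns_eq_range[symmetric] span_span
    by (auto simp: orthogonal_def span_columns_eq_range)
  show "col_proj A y \<in> range ((*v) A)" "(y - col_proj A y) \<bullet> (A *v w) = 0"
    unfolding col_proj_eqI[OF p] using p by auto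
qed

lemma col_proj_range_cong:
  "range ((*v) A) = range ((*v) B) \<Longrightarrow> col_proj A y = col_proj B y"
  by (simp add: col_proj_def span_columns_eq_range)

lemma norm_diff_col_proj: "(norm (y - col_proj A y))\<^sup>2 = (norm y)\<^sup>2 - (norm (col_proj A y))\<^sup>2"
proof -
  obtain w where w: "col_proj A y = A *v w" using col_proj_in_range by blast
  have "(y - col_proj A y) \<bullet> col_proj A y = 0"
    by (metis w col_proj_orthogonal)
  then show ?thesis
    by (simp add: power2_norm_eq_inner inner_diff inner_commute)
qed

lemma norm_col_proj_le: "norm (col_proj A y) \<le> norm y"
  using norm_diff_col_proj[of y A] by (metis diff_ge_0_iff_ge norm_ge_zero power2_le_imp_le zero_le_power2)

lemma norm_diff_col_proj_pythagoras:
  "(norm (y - A *v w))\<^sup>2 = (norm (y - col_proj A y))\<^sup>2 + (norm (col_proj A y - A *v w))\<^sup>2"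
proof -
  obtain u where u: "col_proj A y = A *v u" using col_proj_in_range by blast
  have "(y - col_proj A y) \<bullet> (col_proj A y - A *v w) = 0"
    by (metis u col_proj_orthogonal matrix_vector_mult_diff_distrib)
  then have "(norm ((y - col_proj A y) + (col_proj A y - A *v w)))\<^sup>2 =
      (norm (y - col_proj A y))\<^sup>2 + (norm (col_proj A y - A *v w))\<^sup>2"
    by (intro norm_add_Pythagorean) (simp add: orthogonal_def)
  then show ?thesis by simp
qed

lemma norm_diff_col_proj_le: "norm (y - col_proj A y) \<le> norm (y - A *v w)"
  using norm_diff_col_proj_pythagoras[of y A w]
  by (metis le_add_same_cancel1 norm_ge_zero power2_le_imp_le zero_le_power2)

lemma col_proj_mult: "col_proj A (A *v w) = A *v w"
  by (rule col_proj_eqI) auto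

text \<open>Linearity of the projection, the trace identity and the noise term of the excess risk
  are all read off from this expansion, which has exactly as many summands as the rank.\<close>

lemma col_proj_orthonormal:
  fixes A :: "real^'c^'n"
  obtains B where "finite B" "card B = rank A"
    "\<And>b b'. b \<in> B \<Longrightarrow> b' \<in> B \<Longrightarrow> b \<bullet> b' = (if b = b' then 1 else 0)"
    "\<And>y. col_proj A y = (\<Sum>b\<in>B. (b \<bullet> y) *\<^sub>R b)"
proof -
  have "subspace (range ((*v) A))"
    by (metis span_columns_eq_range subspace_span)
  from orthonormal_basis_subspace[OF this] obtain B where
    B: "B \<subseteq> range ((*v) A)" "pairwise orthogonal B" "\<And>x. x \<in> B \<Longrightarrow> norm x = 1"
      "independent B" "card B = dim (range ((*v) A))" "span B = range ((*v) A)" by metis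
  have fin: "finite B" using B(4) independent_bound by blast
  have on: "b \<bullet> b' = (if b = b' then 1 else 0)" if "b \<in> B" "b' \<in> B" for b b'
    using that B(2,3) by (auto simp: pairwise_def orthogonal_def norm_eq_1)
  have "col_proj A y = (\<Sum>b\<in>B. (b \<bullet> y) *\<^sub>R b)" for y
  proof (rule col_proj_eqI)
    show "(\<Sum>b\<in>B. (b \<bullet> y) *\<^sub>R b) \<in> range ((*v) A)"
      unfolding B(6)[symmetric] by (intro span_sum span_scale span_base)
    have "orthogonal (y - (\<Sum>b\<in>B. (b \<bullet> y) *\<^sub>R b)) z" if "z \<in> span B" for z
    proof (rule orthogonal_to_span[OF that])
      fix b assume "b \<in> B"
      have *: "(\<Sum>b\<in>B. (b \<bullet> y) *\<^sub>R b) \<bullet> b = (\<Sum>c\<in>B. if c = b then b \<bullet> y else 0)"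
        unfolding inner_sum_left by (intro sum.cong) (auto simp: on \<open>b \<in> B\<close>)
      then show "orthogonal (y - (\<Sum>b\<in>B. (b \<bullet> y) *\<^sub>R b)) b"
        using fin \<open>b \<in> B\<close> by (simp add: orthogonal_def inner_diff_left inner_commute[of y])
    qed
    then show "(y - (\<Sum>b\<in>B. (b \<bullet> y) *\<^sub>R b)) \<bullet> (A *v w) = 0" for w
      unfolding B(6) by (auto simp: orthogonal_def)
  qed
  then show thesis
    using that fin on B(5) by (simp add: rank_dim_range)
qed

lemma linear_col_proj: "linear (col_proj A)"
proof -
  obtain B where "\<And>y. col_proj A y = (\<Sum>b\<in>B. (b \<bullet> y) *\<^sub>R b)"
    using col_proj_orthonormal by metis
  then have "col_proj A = (\<lambda>y. \<Sum>b\<in>B. (b \<bullet> y) *\<^sub>R b)" by blast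
  then show ?thesis
    by (auto intro!: linearI sum.cong simp: inner_add_right scaleR_add_left sum.distrib scaleR_sum_right)
qed

lemma col_proj_add: "col_proj A (x + y) = col_proj A x + col_proj A y"
  and col_proj_scaleR: "col_proj A (c *\<^sub>R x) = c *\<^sub>R col_proj A x"
  using linear_col_proj[of A] by (simp_all add: linear_add linear_scale)

lemma norm_sum_orthonormal:
  assumes "finite B" "\<And>b b'. b \<in> B \<Longrightarrow> b' \<in> B \<Longrightarrow> b \<bullet> b' = (if b = b' then 1 else 0)"
  shows "(norm (\<Sum>b\<in>B. c b *\<^sub>R b))\<^sup>2 = (\<Sum>b\<in>B. (c b)\<^sup>2)"
proof -
  have "(norm (\<Sum>b\<in>B. c b *\<^sub>R b))\<^sup>2 = (\<Sum>b\<in>B. \<Sum>b'\<in>B. if b' = b then (c b)\<^sup>2 else 0)"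
    unfolding power2_norm_eq_inner inner_sum_left inner_sum_right
    by (intro sum.cong refl) (auto simp: assms power2_eq_square)
  then show ?thesis using assms(1) by simp
qed

text \<open>Both sides are the trace of the orthogonal projection. The identity supplies the
  constant in the mean of a rotation invariant projection and also makes the rank a measurable
  function of the matrix.\<close>

lemma sum_norm_col_proj_axis:
  "(\<Sum>i\<in>UNIV. (norm (col_proj A (axis i 1)))\<^sup>2) = real (rank (A :: real^'c^'n))"
proof -
  obtain B where B: "finite B" "card B = rank A"
    "\<And>b b'. b \<in> B \<Longrightarrow> b' \<in> B \<Longrightarrow> b \<bullet> b' = (if b = b' then 1 else 0)"
    "\<And>y. col_proj A y = (\<Sum>b\<in>B. (b \<bullet> y) *\<^sub>R b)"
    using col_proj_orthonormal by blast
  have "(\<Sum>i\<in>UNIV. (norm (col_proj A (axis i 1)))\<^sup>2) = (\<Sum>i\<in>UNIV. \<Sum>b\<in>B. (b $ i)\<^sup>2)"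
    using B(1,3) by (simp add: B(4) norm_sum_orthonormal inner_axis)
  also have "\<dots> = (\<Sum>b\<in>B. b \<bullet> b)"
    by (subst sum.swap) (simp add: inner_vec_def power2_eq_square)
  also have "\<dots> = real (rank A)"
    using B(2,3) by simp
  finally show ?thesis .
qed

text \<open>The projection attains the minimum, so \<open>arg_min\<close> returns some minimiser; by
  Pythagoras every minimiser has the projection as its fitted vector.\<close>

lemma mult_least_squares: "A *v least_squares A y = col_proj A y"
proof -
  obtain w where w: "col_proj A y = A *v w" using col_proj_in_range by blast
  have "is_arg_min (\<lambda>w. (norm (y - A *v w))\<^sup>2) (\<lambda>_. True) w"
    using norm_diff_col_proj_le[of y A] by (auto simp: is_arg_min_def not_less w intro!: power_mono)
  then have "is_arg_min (\<lambda>w. (norm (y - A *v w))\<^sup>2) (\<lambda>_. True) (least_squares A y)"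
    unfolding least_squares_def arg_min_def by (rule someI)
  then have "(norm (y - A *v least_squares A y))\<^sup>2 \<le> (norm (y - col_proj A y))\<^sup>2"
    by (auto simp: is_arg_min_def not_less w)
  then have "(norm (col_proj A y - A *v least_squares A y))\<^sup>2 \<le> 0"
    by (simp add: norm_diff_col_proj_pythagoras[of y A "least_squares A y"])
  then show ?thesis by simp
qed

text \<open>The solution set is closed and nonempty, so it has a point nearest to 0. Hence the
  \<open>arg_min\<close> is attained and inherits the defining equation.\<close>

lemma mult_w_star: "X *v w_star X f = col_proj X f"
proof -
  let ?P = "\<lambda>w. X *v w = col_proj X f"
  have "continuous_on UNIV ((*v) X)"
    by (intro linear_continuous_on) (simp add: linear_conv_bounded_linear[symmetric])
  then have "closed {w. ?P w}"
    by (intro closed_Collect_eq) auto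
  moreover have "{w. ?P w} \<noteq> {}" using col_proj_in_range[of X f] by force
  ultimately have "\<exists>w \<in> {w. ?P w}. \<forall>v \<in> {w. ?P w}. dist 0 w \<le> dist 0 v"
    by (rule distance_attains_inf[where a = 0]) blast
  then obtain w where "?P w" "\<And>v. ?P v \<Longrightarrow> dist 0 w \<le> dist 0 v"
    by blast
  then have "is_arg_min norm ?P w"
    by (auto simp: is_arg_min_def not_less)
  then have "is_arg_min norm ?P (w_star X f)"
    unfolding w_star_def arg_min_def by (rule someI)
  then show ?thesis by (simp add: is_arg_min_def)
qed

section \<open>Bias and variance in the excess risk\<close>

lemma white_noise_inner:
  assumes M: "prob_space M" and wn: "white_noise M \<sigma> \<xi>"
  shows "integrable M (\<lambda>\<omega>. b \<bullet> \<xi> \<omega>)" "(LINT \<omega>|M. b \<bullet> \<xi> \<omega>) = 0"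
    "integrable M (\<lambda>\<omega>. (b \<bullet> \<xi> \<omega>)\<^sup>2)" "(LINT \<omega>|M. (b \<bullet> \<xi> \<omega>)\<^sup>2) = \<sigma>\<^sup>2 * (norm b)\<^sup>2"
proof -
  interpret prob_space M by fact
  have \<xi>: "\<xi> \<in> borel_measurable M"
    and sq: "integrable M (\<lambda>\<omega>. (\<xi> \<omega> $ i)\<^sup>2)"
    and mean: "(LINT \<omega>|M. \<xi> \<omega> $ i) = 0"
    and cov: "(LINT \<omega>|M. \<xi> \<omega> $ i * \<xi> \<omega> $ j) = (if i = j then \<sigma>\<^sup>2 else 0)" for i j
    using wn by (auto simp: white_noise_def power2_eq_square)
  have nth: "(\<lambda>\<omega>. \<xi> \<omega> $ i) \<in> borel_measurable M" for i
    using measurable_compose[OF \<xi>, of "\<lambda>x. x $ i" borel]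
    by (simp add: borel_measurable_continuous_onI continuous_intros)
  have int: "integrable M (\<lambda>\<omega>. \<xi> \<omega> $ i)" for i
    by (rule square_integrable_imp_integrable[OF nth sq])
  \<comment> \<open>Products of entries are dominated by sums of squares, so finite second moments
    make all covariances integrable.\<close>
  have "\<bar>x * y\<bar> \<le> x\<^sup>2 + y\<^sup>2" for x y :: real
    using sum_squares_bound[of "\<bar>x\<bar>" "\<bar>y\<bar>"]
    mult_nonneg_nonneg[of "\<bar>x\<bar>" "\<bar>y\<bar>"] unfolding abs_mult power2_abs by linarith
  then have prod: "integrable M (\<lambda>\<omega>. \<xi> \<omega> $ i * \<xi> \<omega> $ j)" for i j
    by (intro Bochner_Integration.integrable_bound[OF Bochner_Integration.integrable_add[OF sq[of i] sq[of j]]])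
       (use nth in auto)
  have inner: "(b \<bullet> x) = (\<Sum>i\<in>UNIV. b $ i * x $ i)" for x
    by (simp add: inner_vec_def)
  have square: "(b \<bullet> x)\<^sup>2 = (\<Sum>i\<in>UNIV. \<Sum>j\<in>UNIV. b $ i * b $ j * (x $ i * x $ j))" for x
    unfolding inner power2_eq_square sum_product by (simp add: mult_ac)
  show "integrable M (\<lambda>\<omega>. b \<bullet> \<xi> \<omega>)" "(LINT \<omega>|M. b \<bullet> \<xi> \<omega>) = 0"
    unfolding inner by (simp_all add: int mean)
  show "integrable M (\<lambda>\<omega>. (b \<bullet> \<xi> \<omega>)\<^sup>2)"
    unfolding square by (simp add: prod)
  have "(LINT \<omega>|M. (b \<bullet> \<xi> \<omega>)\<^sup>2) = (\<Sum>i\<in>UNIV. \<Sum>j\<in>UNIV. if j = i then \<sigma>\<^sup>2 * (b $ i * b $ i) else 0)"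
    unfolding square
    by (simp add: prod cov if_distrib[of "(*) _"] power2_eq_square mult_ac cong: if_cong)
  then show "(LINT \<omega>|M. (b \<bullet> \<xi> \<omega>)\<^sup>2) = \<sigma>\<^sup>2 * (norm b)\<^sup>2"
    by (simp add: power2_norm_eq_inner inner sum_distrib_left)
qed

lemma excess_risk_eq:
  fixes X :: "real^'d^'n" and R :: "real^'k^'d"
  assumes M: "prob_space M" and wn: "white_noise M \<sigma> \<xi>"
  shows "excess_risk M \<xi> f X R =
    ((norm (col_proj X f))\<^sup>2 - (norm (col_proj (X ** R) f))\<^sup>2 + \<sigma>\<^sup>2 * real (rank (X ** R)))
      / real CARD('n)"
proof -
  interpret prob_space M by fact
  let ?A = "X ** R"
  obtain B where B: "finite B" "card B = rank ?A"
    "\<And>b b'. b \<in> B \<Longrightarrow> b' \<in> B \<Longrightarrow> b \<bullet> b' = (if b = b' then 1 else 0)"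
    "\<And>y. col_proj ?A y = (\<Sum>b\<in>B. (b \<bullet> y) *\<^sub>R b)"
    using col_proj_orthonormal by blast
  define u where "u = col_proj X f - col_proj ?A f"
  \<comment> \<open>The column space of \<open>X ** R\<close> is contained in that of
    \<open>X\<close>, so projecting onto the larger space first changes nothing.\<close>
  have "col_proj ?A (col_proj X f) = col_proj ?A f"
  proof (rule col_proj_eqI[OF col_proj_in_range])
    fix w
    have "(col_proj X f - col_proj ?A f) \<bullet> (?A *v w) =
        (f - col_proj ?A f) \<bullet> (?A *v w) - (f - col_proj X f) \<bullet> (X *v (R *v w))"
      by (simp add: inner_diff_left matrix_vector_mul_assoc)
    then show "(col_proj X f - col_proj ?A f) \<bullet> (?A *v w) = 0"
      by (simp add: col_proj_orthogonal)
  qed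
  then have u: "(norm u)\<^sup>2 = (norm (col_proj X f))\<^sup>2 - (norm (col_proj ?A f))\<^sup>2"
    unfolding u_def using norm_diff_col_proj[of "col_proj X f" ?A] by simp
  \<comment> \<open>Bias, cross term and variance. The cross term is linear in the noise and has
    mean zero; the last sum has \<open>rank ?A\<close> terms, each of mean
    \<open>\<sigma>\<^sup>2\<close>.\<close>
  have expand: "(norm (X *v w_star X f - ?A *v least_squares ?A (f + \<xi> \<omega>)))\<^sup>2
     = (norm u)\<^sup>2 - 2 * (\<Sum>b\<in>B. (b \<bullet> u) * (b \<bullet> \<xi> \<omega>)) + (\<Sum>b\<in>B. (b \<bullet> \<xi> \<omega>)\<^sup>2)" for \<omega>
  proof -
    have "X *v w_star X f - ?A *v least_squares ?A (f + \<xi> \<omega>) = u - col_proj ?A (\<xi> \<omega>)"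
      by (simp add: mult_w_star mult_least_squares col_proj_add u_def)
    moreover have "(norm (u - col_proj ?A (\<xi> \<omega>)))\<^sup>2
      = (norm u)\<^sup>2 - 2 * (u \<bullet> col_proj ?A (\<xi> \<omega>)) + (norm (col_proj ?A (\<xi> \<omega>)))\<^sup>2"
      by (simp add: power2_norm_eq_inner inner_diff inner_commute)
    moreover have "u \<bullet> col_proj ?A (\<xi> \<omega>) = (\<Sum>b\<in>B. (b \<bullet> u) * (b \<bullet> \<xi> \<omega>))"
      by (simp add: B(4) inner_sum_right inner_commute mult.commute)
    moreover have "(norm (col_proj ?A (\<xi> \<omega>)))\<^sup>2 = (\<Sum>b\<in>B. (b \<bullet> \<xi> \<omega>)\<^sup>2)"
      by (simp add: B(4) norm_sum_orthonormal[OF B(1,3)])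
    ultimately show ?thesis by simp
  qed
  have "(\<Sum>b\<in>B. \<sigma>\<^sup>2 * (norm b)\<^sup>2) = (\<Sum>b\<in>B. \<sigma>\<^sup>2)"
    by (intro sum.cong) (auto simp: power2_norm_eq_inner B(3))
  then have "(LINT \<omega>|M. (norm u)\<^sup>2 - 2 * (\<Sum>b\<in>B. (b \<bullet> u) * (b \<bullet> \<xi> \<omega>)) + (\<Sum>b\<in>B. (b \<bullet> \<xi> \<omega>)\<^sup>2))
    = (norm u)\<^sup>2 + \<sigma>\<^sup>2 * real (rank ?A)"
    by (simp add: white_noise_inner[OF M wn] B(2) mult.commute prob_space)
  then show ?thesis
    unfolding excess_risk_def expand by (simp add: u)
qed

section \<open>Isometries and their effect on projections\<close>

lemma inner_matrix_transpose: "x \<bullet> (A *v y) = (transpose A *v x) \<bullet> (y :: real^'m)"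
  by (simp add: dot_lmul_matrix)

lemma matrix_isometry_inner:
  assumes "transpose Q ** Q = mat 1"
  shows "(Q *v x) \<bullet> (Q *v y) = x \<bullet> (y :: real^'m)"
proof -
  have "(Q *v x) \<bullet> (Q *v y) = x \<bullet> ((transpose Q ** Q) *v y)"
    unfolding matrix_vector_mul_assoc[symmetric] inner_matrix_transpose[of x "transpose Q"]
      transpose_transpose by (rule refl)
  then show ?thesis by (simp add: assms)
qed

lemma matrix_isometry_norm:
  assumes "transpose Q ** Q = mat 1"
  shows "norm (Q *v x) = norm (x :: real^'m)"
  by (simp add: norm_eq_sqrt_inner matrix_isometry_inner[OF assms])

text \<open>An isometry carries the column space of \<open>B\<close> onto that of
  \<open>Q ** B\<close> and preserves orthogonality. It is applied to rotations, to the factor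
  \<open>U\<close> of the decomposition, and to \<open>transpose V\<close> when \<open>V\<close> is
  square.\<close>

lemma col_proj_isometry_mult:
  fixes Q :: "real^'m^'n" and B :: "real^'k^'m"
  assumes "transpose Q ** Q = mat 1"
  shows "col_proj (Q ** B) f = Q *v col_proj B (transpose Q *v f)"
proof (rule col_proj_eqI)
  show "Q *v col_proj B (transpose Q *v f) \<in> range ((*v) (Q ** B))"
  proof -
    obtain w where "col_proj B (transpose Q *v f) = B *v w"
      using col_proj_in_range by blast
    then have "Q *v col_proj B (transpose Q *v f) = (Q ** B) *v w"
      by (simp only: matrix_vector_mul_assoc)
    then show ?thesis by (simp only: rangeI)
  qed
  show "(f - Q *v col_proj B (transpose Q *v f)) \<bullet> (Q ** B *v w) = 0" for w
    using col_proj_orthogonal[of "transpose Q *v f" B w]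
    unfolding inner_diff_left matrix_vector_mul_assoc[symmetric] matrix_isometry_inner[OF assms]
      inner_matrix_transpose[of f Q] by simp
qed

lemma inj_matrix_mult:
  "inj ((*v) A) \<Longrightarrow> inj ((*v) B) \<Longrightarrow> inj ((*v) (A ** (B :: real^'k^'m)))"
  unfolding inj_def matrix_vector_mul_assoc[symmetric] by blast

subsection \<open>The law of a Gaussian matrix\<close>

lemma borel_measurable_norm_col_proj [measurable]:
  "(\<lambda>A :: real^'c^'n. (norm (col_proj A y))\<^sup>2) \<in> borel_measurable borel"
proof -
  have "(\<lambda>A :: real^'c^'n. norm (y - col_proj A y)) \<in> borel_measurable borel"
    unfolding borel_measurable_iff_less
  proof
    fix a
    have "{A \<in> space (borel :: (real^'c^'n) measure). norm (y - col_proj A y) < a} = (\<Union>w. {A. norm (y - A *v w) < a})"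
    proof safe
      fix A :: "real^'c^'n" assume "norm (y - col_proj A y) < a"
      moreover obtain w where "col_proj A y = A *v w" using col_proj_in_range by blast
      ultimately show "A \<in> (\<Union>w. {A. norm (y - A *v w) < a})" by auto
    qed (auto intro: le_less_trans[OF norm_diff_col_proj_le])
    moreover have "open (\<Union>w. {A :: real^'c^'n. norm (y - A *v w) < a})"
      by (intro open_UN ballI open_Collect_less continuous_intros)
        (auto simp: matrix_vector_mult_def intro!: continuous_intros)
    ultimately show "{A \<in> space (borel :: (real^'c^'n) measure). norm (y - col_proj A y) < a} \<in> sets borel"
      by (simp only: borel_open)
  qed
  then have "(\<lambda>A :: real^'c^'n. (norm y)\<^sup>2 - (norm (y - col_proj A y))\<^sup>2) \<in> borel_measurable borel"
    by (intro borel_measurable_diff borel_measurable_power borel_measurable_const)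
  then show ?thesis by (simp add: norm_diff_col_proj)
qed

lemma borel_measurable_rank [measurable]:
  "(\<lambda>A :: real^'c^'n. real (rank A)) \<in> borel_measurable borel"
  unfolding sum_norm_col_proj_axis[symmetric] by measurable

lemma sets_inj_matrix [measurable]: "{A :: real^'c^'n. inj ((*v) A)} \<in> sets borel"
proof -
  have "{A :: real^'c^'n. inj ((*v) A)} = {A \<in> space borel. real (rank A) = real CARD('c)}"
    by (simp add: full_rank_injective)
  also have "\<dots> \<in> sets borel" by measurable
  finally show ?thesis .
qed

section \<open>Rotation invariance of Lebesgue measure\<close>

text \<open>The uniqueness argument for Haar measure: the image measure is again translation
  invariant, so it is proportional to \<open>lborel\<close>. The unit ball, which \<open>T\<close>
  preserves, fixes the factor as 1.\<close>

lemma lborel_distr_orthogonal: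
  fixes T :: "'a::euclidean_space \<Rightarrow> 'a"
  assumes T: "linear T" "\<And>x. norm (T x) = norm x"
  shows "distr lborel borel T = lborel"
proof -
  have ot: "orthogonal_transformation T"
    using T by (simp add: orthogonal_transformation)
  have cont: "continuous_on UNIV T"
    using T(1) by (simp add: linear_continuous_on linear_conv_bounded_linear)
  then have meas [measurable]: "T \<in> borel_measurable borel"
    by (rule borel_measurable_continuous_onI)
  define \<mu> where "\<mu> = distr lborel borel T"
  have sets_\<mu> [measurable_cong]: "sets \<mu> = sets borel" by (simp add: \<mu>_def)
  have shift_\<mu>: "(\<integral>\<^sup>+y. g (c + y) \<partial>\<mu>) = (\<integral>\<^sup>+y. g y \<partial>\<mu>)" if [measurable]: "g \<in> borel_measurable borel"
    for g :: "'a \<Rightarrow> ennreal" and c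
  proof -
    obtain d where d: "c = T d" using orthogonal_transformation_surj[OF ot] by (metis surjD)
    have "(\<integral>\<^sup>+y. g (c + y) \<partial>\<mu>) = (\<integral>\<^sup>+y. g (T (d + y)) \<partial>lborel)"
      by (simp add: \<mu>_def nn_integral_distr d linear_add[OF T(1)])
    also have "\<dots> = (\<integral>\<^sup>+y. g (T y) \<partial>distr lborel borel ((+) d))"
      by (simp add: nn_integral_distr)
    also have "\<dots> = (\<integral>\<^sup>+y. g y \<partial>\<mu>)"
      by (simp add: lborel_distr_plus \<mu>_def nn_integral_distr)
    finally show ?thesis .
  qed
  have shift_lborel: "(\<integral>\<^sup>+y. g (y + c) \<partial>lborel) = (\<integral>\<^sup>+y. g y \<partial>lborel)"
    if [measurable]: "g \<in> borel_measurable borel" for g :: "'a \<Rightarrow> ennreal" and c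
  proof -
    have "(\<integral>\<^sup>+y. g (y + c) \<partial>lborel) = (\<integral>\<^sup>+y. g y \<partial>distr lborel borel ((+) c))"
      by (simp add: nn_integral_distr add.commute)
    then show ?thesis by (simp add: lborel_distr_plus)
  qed
  have fin: "emeasure lborel (ball (0::'a) 1) < \<infinity>"
    by (rule emeasure_bounded_finite) simp
  have "emeasure lborel (ball (0::'a) 1) = ennreal (measure lborel (ball (0::'a) 1))"
    using fin by (intro emeasure_eq_ennreal_measure) auto
  then have pos: "emeasure lborel (ball (0::'a) 1) > 0"
    by (simp add: content_ball_pos)
  have ball: "emeasure \<mu> (ball 0 r) = emeasure lborel (ball (0::'a) r)" for r
  proof -
    have "T -` ball 0 r = ball 0 r" using T(2) by (auto simp: dist_norm)
    then show ?thesis by (simp add: \<mu>_def emeasure_distr)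
  qed
  have sigma_\<mu>: "sigma_finite_measure \<mu>"
  proof
    have "(\<Union>n. ball (0::'a) (real n)) = UNIV"
      by (auto simp: dist_norm reals_Archimedean2)
    moreover have "emeasure \<mu> (ball 0 (real n)) \<noteq> \<infinity>" for n
      using emeasure_bounded_finite[of "ball (0::'a) (real n)"] by (simp add: ball)
    ultimately show "\<exists>A. countable A \<and> A \<subseteq> sets \<mu> \<and> \<Union>A = space \<mu> \<and> (\<forall>a\<in>A. emeasure \<mu> a \<noteq> \<infinity>)"
      by (intro exI[of _ "range (\<lambda>n. ball (0::'a) (real n))"]) (auto simp: \<mu>_def)
  qed
  interpret \<mu>: sigma_finite_measure \<mu> by (rule sigma_\<mu>)
  interpret pair_sigma_finite lborel \<mu> ..
  have "emeasure \<mu> A = emeasure lborel A" if [measurable]: "A \<in> sets borel" for A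
  proof -
    let ?B = "ball (0::'a) 1"
    have [measurable]: "?B \<in> sets borel" by simp
    \<comment> \<open>Evaluating the double integral of
      \<open>indicator ?B x * indicator A (x + y)\<close> in both orders compares the two products
      of measures; the factor of the ball is finite and positive and cancels.\<close>
    have "emeasure lborel ?B * emeasure \<mu> A
        = (\<integral>\<^sup>+x. indicator ?B x * (\<integral>\<^sup>+y. indicator A (x + y) \<partial>\<mu>) \<partial>lborel)"
      by (subst shift_\<mu>) (simp_all add: nn_integral_multc sets_\<mu>)
    also have "\<dots> = (\<integral>\<^sup>+x. \<integral>\<^sup>+y. indicator ?B x * indicator A (x + y) \<partial>\<mu> \<partial>lborel)"
      by (subst nn_integral_cmult) auto
    also have "\<dots> = (\<integral>\<^sup>+y. \<integral>\<^sup>+x. indicator ?B x * indicator A (x + y) \<partial>lborel \<partial>\<mu>)"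
      by (rule Fubini'[symmetric]) (unfold split_beta', measurable)
    also have "\<dots> = (\<integral>\<^sup>+y. \<integral>\<^sup>+x. indicator ?B (x - y) * indicator A x \<partial>lborel \<partial>\<mu>)"
    proof (rule nn_integral_cong)
      fix y
      show "(\<integral>\<^sup>+x. indicator ?B x * indicator A (x + y) \<partial>lborel)
          = (\<integral>\<^sup>+x. indicator ?B (x - y) * indicator A x \<partial>lborel)"
        using shift_lborel[of "\<lambda>x. indicator ?B (x - y) * indicator A x" y] by simp
    qed
    also have "\<dots> = (\<integral>\<^sup>+x. \<integral>\<^sup>+y. indicator ?B (x - y) * indicator A x \<partial>\<mu> \<partial>lborel)"
      by (rule Fubini') (unfold split_beta', measurable)
    \<comment> \<open>The ball is symmetric about 0, which turns the inner integrand into the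
      indicator of a translate of the ball in the variable \<open>y\<close>.\<close>
    also have "\<dots> = (\<integral>\<^sup>+x. (\<integral>\<^sup>+y. indicator ?B (- x + y) \<partial>\<mu>) * indicator A x \<partial>lborel)"
      by (subst nn_integral_multc[symmetric])
        (auto intro!: nn_integral_cong simp: indicator_def dist_norm norm_minus_commute)
    also have "\<dots> = emeasure lborel ?B * emeasure lborel A"
      by (subst shift_\<mu>) (simp_all add: nn_integral_cmult ball sets_\<mu>)
    finally show ?thesis
      using pos fin by (auto simp: ennreal_mult_cancel_left)
  qed
  then show ?thesis
    unfolding \<mu>_def by (intro measure_eqI) auto
qed

section \<open>The radial density of a Gaussian matrix\<close>

lemma Basis_matrix: "Basis = range (\<lambda>(i, j). axis i (axis j 1) :: real^'c^'r)"
  by (auto simp: Basis_vec_def image_iff)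

lemma inj_axis_axis: "inj (\<lambda>(i, j). axis i (axis j 1) :: real^'c^'r)"
  by (auto simp: inj_def axis_eq_axis)

lemma borel_measurable_iid_normal_matrix:
  assumes "prob_space M" "iid_normal_matrix M v A"
  shows "A \<in> borel_measurable M"
proof -
  interpret prob_space M by fact
  have "(\<lambda>\<omega>. A \<omega> $ i $ j) \<in> borel_measurable M" for i j
    using assms(2) by (auto simp: iid_normal_matrix_def distributed_def)
  then show ?thesis
    by (subst borel_measurable_euclidean_space) (auto simp: Basis_matrix inner_axis)
qed

text \<open>A product of centred normal densities of equal variance depends only on the sum of the
  squared entries, that is, on the norm of the matrix. No product measure is set up: the law divided
  by the joint density \<open>F\<close> is recognised as \<open>lborel\<close> by its values on
  boxes.\<close>

lemma distr_iid_normal_matrix: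
  fixes A :: "'w \<Rightarrow> real^'c^'r"
  assumes M: "prob_space M" and iid: "iid_normal_matrix M v A" and v: "v > 0"
  obtains h where "h \<in> borel_measurable borel" "distr M borel A = density lborel (\<lambda>x. h (norm x))"
proof -
  interpret prob_space M by fact
  have [measurable]: "A \<in> borel_measurable M"
    using borel_measurable_iid_normal_matrix[OF M iid] .
  have indep: "indep_vars (\<lambda>_. borel) (\<lambda>(i, j) \<omega>. A \<omega> $ i $ j) UNIV"
    and dist: "distributed M lborel (\<lambda>\<omega>. A \<omega> $ i $ j) (normal_density 0 (sqrt v))" for i j
    using iid by (auto simp: iid_normal_matrix_def)
  define \<phi> where "\<phi> = normal_density 0 (sqrt v)"
  have \<phi>_pos: "\<phi> x > 0" for x using v by (simp add: \<phi>_def normal_density_pos)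
  have [measurable]: "\<phi> \<in> borel_measurable borel" by (simp add: \<phi>_def)
  define F :: "real^'c^'r \<Rightarrow> real" where "F x = (\<Prod>p\<in>UNIV. \<phi> (x $ fst p $ snd p))" for x
  define h where "h t = ennreal ((1 / sqrt (2 * pi * v)) ^ CARD('r \<times> 'c) * exp (- t\<^sup>2 / (2 * v)))" for t
  have F_pos: "F x > 0" for x by (simp add: F_def \<phi>_pos prod_pos)
  have nth [measurable]: "(\<lambda>x :: real^'c^'r. x $ i $ j) \<in> borel_measurable borel" for i j
    by (intro borel_measurable_continuous_onI continuous_intros)
  have [measurable]: "F \<in> borel_measurable borel" unfolding F_def by measurable
  have F_h: "ennreal (F x) = h (norm x)" for x
  proof -
    have "(norm x)\<^sup>2 = (\<Sum>p\<in>UNIV. (x $ fst p $ snd p)\<^sup>2)"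
      unfolding power2_norm_eq_inner inner_vec_def
      by (simp add: power2_eq_square sum.cartesian_product case_prod_unfold)
    then have "(\<Prod>p\<in>UNIV. exp (- (x $ fst p $ snd p)\<^sup>2 / (2 * v))) = exp (- (norm x)\<^sup>2 / (2 * v))"
      by (simp add: exp_sum[symmetric] sum_negf sum_divide_distrib)
    then show ?thesis
      using v by (simp add: h_def F_def \<phi>_def normal_density_def prod_dividef power_divide)
  qed
  let ?N = "distr M borel A"
  have "lborel = density ?N (\<lambda>x. ennreal (1 / F x))"
  proof (rule lborel_eqI)
    fix l u :: "real^'c^'r" assume lu: "\<And>b. b \<in> Basis \<Longrightarrow> l \<bullet> b \<le> u \<bullet> b"
    have lu': "l $ i $ j \<le> u $ i $ j" for i j
    proof -
      have "axis i (axis j 1) \<in> (Basis :: (real^'c^'r) set)" by (auto simp: Basis_matrix image_iff)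
      from lu[OF this] show ?thesis by (simp add: inner_axis)
    qed
    let ?l = "\<lambda>p. l $ fst p $ snd p" and ?u = "\<lambda>p. u $ fst p $ snd p"
    define G where "G p y = ennreal (indicator {?l p<..<?u p} y / \<phi> y)" for p y
    have [measurable]: "G p \<in> borel_measurable borel" for p unfolding G_def by measurable
    have box: "x \<in> box l u \<longleftrightarrow> (\<forall>p. x $ fst p $ snd p \<in> {?l p<..<?u p})" for x
      by (auto simp: mem_box Basis_matrix inner_axis)
    \<comment> \<open>The indicator of a box and \<open>1 / F\<close> both factor over the entries,
      so independence will turn the integral of this product into a product of integrals.\<close>
    have G: "ennreal (1 / F x) * indicator (box l u) x = (\<Prod>p\<in>UNIV. G p (x $ fst p $ snd p))" for x
    proof (cases "x \<in> box l u")
      case True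
      then have "(\<Prod>p\<in>UNIV. G p (x $ fst p $ snd p)) = (\<Prod>p\<in>UNIV. ennreal (1 / \<phi> (x $ fst p $ snd p)))"
        by (intro prod.cong) (auto simp: box G_def)
      also have "\<dots> = ennreal (1 / F x)"
        by (subst prod_ennreal) (auto simp: F_def prod_dividef \<phi>_pos less_imp_le)
      finally show ?thesis using True by simp
    next
      case False
      then obtain p where "x $ fst p $ snd p \<notin> {?l p<..<?u p}" unfolding box by blast
      then have "G p (x $ fst p $ snd p) = 0" by (simp add: G_def)
      then have "(\<Prod>p\<in>UNIV. G p (x $ fst p $ snd p)) = 0" by (intro prod_zero bexI[of _ p]) auto
      then show ?thesis using False by simp
    qed
    \<comment> \<open>The factor \<open>1 / \<phi>\<close> cancels the density of the entry and
      leaves the length of the interval.\<close>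
    have int_G: "(\<integral>\<^sup>+\<omega>. G p (A \<omega> $ fst p $ snd p) \<partial>M) = ennreal (?u p - ?l p)" for p
    proof -
      have "(\<integral>\<^sup>+\<omega>. G p (A \<omega> $ fst p $ snd p) \<partial>M) = (\<integral>\<^sup>+y. \<phi> y * G p y \<partial>lborel)"
        using distributed_nn_integral[OF dist[of "fst p" "snd p"], of "G p"] by (simp add: \<phi>_def)
      also have "\<dots> = (\<integral>\<^sup>+y. indicator {?l p<..<?u p} y \<partial>lborel)"
        by (intro nn_integral_cong)
          (auto simp: G_def indicator_def ennreal_mult[symmetric] \<phi>_pos less_imp_le less_imp_neq[symmetric])
      also have "\<dots> = ennreal (?u p - ?l p)"
        by (simp add: lu')
      finally show ?thesis .
    qed
    have "emeasure (density ?N (\<lambda>x. ennreal (1 / F x))) (box l u)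
        = (\<integral>\<^sup>+\<omega>. (\<Prod>p\<in>UNIV. G p (A \<omega> $ fst p $ snd p)) \<partial>M)"
      by (simp add: emeasure_density nn_integral_distr G)
    also have "\<dots> = (\<Prod>p\<in>UNIV. \<integral>\<^sup>+\<omega>. G p (A \<omega> $ fst p $ snd p) \<partial>M)"
      using indep_vars_compose2[OF indep, of G "\<lambda>_. borel"]
      by (intro indep_vars_nn_integral) (auto simp: case_prod_unfold)
    also have "\<dots> = ennreal (\<Prod>p\<in>UNIV. ?u p - ?l p)"
      unfolding int_G by (intro prod_ennreal) (simp add: lu')
    also have "(\<Prod>p\<in>UNIV. ?u p - ?l p) = (\<Prod>b\<in>Basis. (u - l) \<bullet> b)"
      unfolding Basis_matrix
      by (subst prod.reindex[OF inj_axis_axis]) (simp add: case_prod_unfold inner_axis)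
    finally show "emeasure (density ?N (\<lambda>x. ennreal (1 / F x))) (box l u) = (\<Prod>b\<in>Basis. (u - l) \<bullet> b)" .
  qed simp
  then have "density lborel (\<lambda>x. h (norm x)) = density (density ?N (\<lambda>x. ennreal (1 / F x))) (\<lambda>x. ennreal (F x))"
    by (simp add: F_h)
  also have "\<dots> = density ?N (\<lambda>x. 1)"
    using F_pos by (subst density_density_eq)
      (auto simp: ennreal_mult[symmetric] less_imp_le less_imp_neq[symmetric])
  also have "\<dots> = ?N" by (rule density_1)
  finally have "?N = density lborel (\<lambda>x. h (norm x))" ..
  moreover have "h \<in> borel_measurable borel" unfolding h_def by measurable
  ultimately show thesis using that by blast
qed

subsection \<open>Rotation invariance and generic rank\<close>

lemma matrix_mult_scaleR: "A ** (c *\<^sub>R B) = c *\<^sub>R (A ** (B :: real^'k^'m))"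
  by (simp add: vec_eq_iff matrix_matrix_mult_def sum_distrib_left mult_ac)

lemma scaleR_matrix_mult: "(c *\<^sub>R A) ** B = c *\<^sub>R (A ** (B :: real^'k^'m))"
  by (simp add: vec_eq_iff matrix_matrix_mult_def sum_distrib_left mult_ac)

lemma linear_matrix_mult: "linear ((**) A :: real^'k^'m \<Rightarrow> real^'k^'n)"
  by (rule linearI) (simp_all add: matrix_add_ldistrib matrix_mult_scaleR)

lemma borel_measurable_linear:
  fixes L :: "'a::euclidean_space \<Rightarrow> 'b::euclidean_space"
  shows "linear L \<Longrightarrow> L \<in> borel_measurable borel"
  by (intro borel_measurable_continuous_onI)
    (simp add: linear_continuous_on linear_conv_bounded_linear)

text \<open>The exceptional \<open>t\<close> are the negated eigenvalues of \<open>C\<close>.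
  Working with det(1 + u C) instead of the characteristic polynomial makes it obvious that the
  polynomial is nonzero, since its value at 0 is 1.\<close>

lemma finite_not_inj_scaled_mat_add:
  fixes C :: "real^'k^'k"
  shows "finite {t. \<not> inj ((*v) (C + t *\<^sub>R mat 1))}"
proof -
  define p where "p = det (\<chi> i j. [:(if i = j then 1 else 0), C $ i $ j:])"
  have poly_p: "poly p u = det (mat 1 + u *\<^sub>R C)" for u
    unfolding p_def det_def mat_def
    by (simp add: poly_sum poly_prod)
  then have "poly p 0 = 1" by simp
  then have "p \<noteq> 0" by auto
  then have "finite {u. poly p u = 0}" by (rule poly_roots_finite)
  \<comment> \<open>A nonzero \<open>t\<close> corresponds to the root u = 1/t; the value
    \<open>t = 0\<close> has no such counterpart and is added by hand.\<close>
  moreover have "{t. \<not> inj ((*v) (C + t *\<^sub>R mat 1))} \<subseteq> insert 0 (inverse ` {u. poly p u = 0})"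
  proof
    fix t assume t: "t \<in> {t. \<not> inj ((*v) (C + t *\<^sub>R mat 1))}"
    have "poly p (inverse t) = 0" if "t \<noteq> 0"
    proof -
      have "mat 1 + inverse t *\<^sub>R C = inverse t *\<^sub>R (C + t *\<^sub>R mat 1)"
        using that by (simp add: scaleR_add_right)
      moreover have "det (inverse t *\<^sub>R (C + t *\<^sub>R mat 1)) = 0"
      proof -
        obtain x y where "x \<noteq> y" "(C + t *\<^sub>R mat 1) *v x = (C + t *\<^sub>R mat 1) *v y"
          using t by (auto simp: inj_def)
        then have "\<not> inj ((*v) (inverse t *\<^sub>R (C + t *\<^sub>R mat 1)))"
          unfolding inj_def scaleR_matrix_vector_assoc[symmetric] by metis
        then show ?thesis
          using det_nz_iff_inj[of "(*v) (inverse t *\<^sub>R (C + t *\<^sub>R mat 1))"]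
          by (simp only: matrix_of_matrix_vector_mul matrix_vector_mul_linear simp_thms)
      qed
      ultimately show ?thesis unfolding poly_p by simp
    qed
    then show "t \<in> insert 0 (inverse ` {u. poly p u = 0})"
      by (cases "t = 0") (auto intro!: image_eqI[of _ _ "inverse t"])
  qed
  ultimately show ?thesis by (meson finite_imageI finite_insert finite_subset)
qed

text \<open>Integrating the exceptional set over all its translates along \<open>x0\<close> gives zero, because each
  line in direction \<open>x0\<close> meets it in finitely many points.\<close>

lemma AE_lborel_inj_linear:
  fixes L :: "'a::euclidean_space \<Rightarrow> real^'k^'m"
  assumes L: "linear L" and x0: "inj ((*v) (L x0))"
  shows "AE x in lborel. inj ((*v) (L x))"
proof -
  define N where "N = {x. \<not> inj ((*v) (L x))}"
  have [measurable]: "L \<in> borel_measurable borel"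
    by (rule borel_measurable_linear[OF L])
  have "N = L -` (- {A. inj ((*v) A)}) \<inter> space borel" by (auto simp: N_def)
  also have "\<dots> \<in> sets borel"
    by (rule measurable_sets[of _ _ borel]) (auto intro: sets_inj_matrix borel_comp)
  finally have [measurable]: "N \<in> sets borel" .
  \<comment> \<open>A left inverse of \<open>L x0\<close> makes the problem square: along the line
    through \<open>x\<close>, multiplying by \<open>B\<close> gives
    \<open>B ** L x + t *\<^sub>R mat 1\<close>, and injectivity of this product implies that of the
    right factor.\<close>
  obtain B where B: "B ** L x0 = mat 1"
    using x0 matrix_left_invertible_injective by blast
  have fin: "finite {t. x + t *\<^sub>R x0 \<in> N}" for x
  proof (rule finite_subset[OF _ finite_not_inj_scaled_mat_add[of "B ** L x"]])
    have "L (x + t *\<^sub>R x0) = L x + t *\<^sub>R L x0" for t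
      by (simp add: linear_add[OF L] linear_scale[OF L])
    then have "B ** L x + t *\<^sub>R mat 1 = B ** L (x + t *\<^sub>R x0)" for t
      by (simp add: matrix_add_ldistrib matrix_mult_scaleR B)
    moreover have "inj ((*v) A)" if "inj ((*v) (B ** A))" for A
      using that unfolding inj_def matrix_vector_mul_assoc[symmetric] by metis
    ultimately show "{t. x + t *\<^sub>R x0 \<in> N} \<subseteq> {t. \<not> inj ((*v) (B ** L x + t *\<^sub>R mat 1))}"
      by (auto simp: N_def)
  qed
  \<comment> \<open>The infinite length of the real line enters as a factor: a set whose measure
    times infinity is 0 must be a null set.\<close>
  have "emeasure lborel N * emeasure lborel (UNIV :: real set)
      = (\<integral>\<^sup>+t. emeasure lborel N \<partial>(lborel :: real measure))"
    by simp
  also have "\<dots> = (\<integral>\<^sup>+t. \<integral>\<^sup>+x. indicator N (x + t *\<^sub>R x0) \<partial>lborel \<partial>(lborel :: real measure))"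
  proof (rule nn_integral_cong)
    fix t :: real
    have "emeasure lborel N = (\<integral>\<^sup>+x. indicator N x \<partial>distr lborel borel ((+) (t *\<^sub>R x0)))"
      by (simp add: lborel_distr_plus)
    also have "\<dots> = (\<integral>\<^sup>+x. indicator N (x + t *\<^sub>R x0) \<partial>lborel)"
      by (subst nn_integral_distr) (simp_all add: add.commute)
    finally show "emeasure lborel N = (\<integral>\<^sup>+x. indicator N (x + t *\<^sub>R x0) \<partial>lborel)" .
  qed
  also have "\<dots> = (\<integral>\<^sup>+x. \<integral>\<^sup>+t. indicator N (x + t *\<^sub>R x0) \<partial>(lborel :: real measure) \<partial>lborel)"
    by (rule lborel_pair.Fubini'[symmetric]) (unfold split_beta', measurable)
  also have "\<dots> = (\<integral>\<^sup>+(x :: 'a). 0 \<partial>lborel)"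
  proof (rule nn_integral_cong)
    fix x
    have "(\<integral>\<^sup>+t. indicator N (x + t *\<^sub>R x0) \<partial>(lborel :: real measure))
        = (\<integral>\<^sup>+t. indicator {t. x + t *\<^sub>R x0 \<in> N} t \<partial>lborel)"
      by (intro nn_integral_cong) (simp add: indicator_def)
    also have "\<dots> = emeasure lborel {t. x + t *\<^sub>R x0 \<in> N}"
      by (intro nn_integral_indicator) (simp add: borel_closed finite_imp_closed fin)
    also have "\<dots> = 0"
      by (rule emeasure_lborel_countable) (simp add: fin countable_finite)
    finally show "(\<integral>\<^sup>+t. indicator N (x + t *\<^sub>R x0) \<partial>(lborel :: real measure)) = 0" .
  qed
  finally have "emeasure lborel N = 0" by (simp add: ennreal_top_mult)
  then have "AE x in lborel. x \<notin> N" by (intro AE_not_in) (simp add: null_sets_def)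
  then show ?thesis by (simp add: N_def)
qed

lemma AE_iid_normal_matrix:
  fixes A :: "'w \<Rightarrow> real^'c^'r"
  assumes "prob_space M" "iid_normal_matrix M v A" "v > 0" "AE x in lborel. P x"
  shows "AE x in distr M borel A. P x"
proof -
  obtain h where [measurable]: "h \<in> borel_measurable borel"
    and h: "distr M borel A = density lborel (\<lambda>x. h (norm x))"
    using distr_iid_normal_matrix[OF assms(1-3)] by blast
  have "(\<lambda>x :: real^'c^'r. h (norm x)) \<in> borel_measurable lborel" by measurable
  then show ?thesis
    unfolding h AE_density[OF \<open>_ \<in> borel_measurable lborel\<close>]
    using assms(4) by (auto elim: eventually_mono)
qed

text \<open>Left multiplication by \<open>Q\<close> rotates every column and so preserves the norm
  of the whole matrix. As an orthogonal map on the space of matrices it leaves Lebesgue measure and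
  the radial density unchanged.\<close>

lemma distr_iid_normal_matrix_orthogonal:
  fixes A :: "'w \<Rightarrow> real^'c^'r"
  assumes "prob_space M" "iid_normal_matrix M v A" "v > 0" and Q: "orthogonal_matrix Q"
  shows "distr (distr M borel A) borel ((**) Q) = distr M borel A"
proof -
  obtain h where [measurable]: "h \<in> borel_measurable borel"
    and h: "distr M borel A = density lborel (\<lambda>x. h (norm x))"
    using distr_iid_normal_matrix[OF assms(1-3)] by blast
  let ?T = "(**) Q :: real^'c^'r \<Rightarrow> _"
  have lin: "linear ?T"
    by (rule linear_matrix_mult)
  then have T: "?T \<in> borel_measurable borel"
    by (rule borel_measurable_linear)
  have norm_matrix: "(norm x)\<^sup>2 = (\<Sum>j\<in>UNIV. (norm (column j x))\<^sup>2)" for x :: "real^'c^'r"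
  proof -
    have "(\<Sum>j\<in>UNIV. (norm (column j x))\<^sup>2) = (\<Sum>j\<in>UNIV. \<Sum>i\<in>UNIV. x $ i $ j * x $ i $ j)"
      by (simp add: power2_norm_eq_inner inner_vec_def column_def)
    also have "\<dots> = (norm x)\<^sup>2"
      by (subst sum.swap) (simp add: power2_norm_eq_inner inner_vec_def)
    finally show ?thesis ..
  qed
  have "norm (Q *v y) = norm y" for y
    using Q by (intro matrix_isometry_norm) (simp add: orthogonal_matrix_def)
  moreover have "column j (Q ** x) = Q *v column j x" for j and x :: "real^'c^'r"
    by (simp add: column_def matrix_matrix_mult_def matrix_vector_mult_def vec_eq_iff)
  ultimately have "(norm (Q ** x))\<^sup>2 = (norm x)\<^sup>2" for x :: "real^'c^'r"
    by (simp add: norm_matrix)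
  then have norm: "norm (Q ** x) = norm x" for x :: "real^'c^'r"
    by (simp add: power2_eq_iff_nonneg)
  have "distr (density lborel (\<lambda>x. h (norm x))) borel ?T
      = distr (density lborel (\<lambda>x. h (norm (Q ** x)))) borel ?T"
    by (simp add: norm)
  also have "\<dots> = density (distr lborel borel ?T) (\<lambda>x. h (norm x))"
    by (rule density_distr[symmetric]) (simp_all add: T)
  also have "distr lborel borel ?T = lborel"
    by (rule lborel_distr_orthogonal[OF lin norm])
  finally show ?thesis by (simp only: h)
qed

lemma rotation_invariant_mean_norm_col_proj:
  fixes N :: "(real^'k^'m) measure"
  assumes N: "prob_space N" "sets N = sets borel"
    and inv: "\<And>Q. orthogonal_matrix Q \<Longrightarrow> distr N borel ((**) Q) = N"
    and inj: "AE A in N. inj ((*v) A)"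
  shows "(LINT A|N. (norm (col_proj A u))\<^sup>2) = real CARD('k) / real CARD('m) * (norm u)\<^sup>2"
proof -
  interpret prob_space N by fact
  note [measurable_cong] = N(2)
  define q where "q u = (LINT A|N. (norm (col_proj A u))\<^sup>2)" for u
  have integrable: "integrable N (\<lambda>A. (norm (col_proj A u))\<^sup>2)" for u
    by (rule integrable_const_bound[of _ "(norm u)\<^sup>2"]) (auto simp: norm_col_proj_le)
  have q_scale: "q (c *\<^sub>R u) = c\<^sup>2 * q u" for c u
    by (simp add: q_def col_proj_scaleR power_mult_distrib)
  \<comment> \<open>Rotating the matrix has the same effect on the norm of the projection as
    rotating \<open>u\<close> backwards, so invariance of the law passes to
    \<open>q\<close>.\<close>
  have q_orthogonal: "q (transpose Q *v u) = q u" if Q: "orthogonal_matrix Q" for Q u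
  proof -
    have QQ: "transpose Q ** Q = mat 1" using Q by (simp add: orthogonal_matrix_def)
    have Q_meas: "(**) Q \<in> borel_measurable N"
      unfolding measurable_cong_sets[OF N(2) refl]
      by (rule borel_measurable_linear[OF linear_matrix_mult])
    have "q u = (LINT A|distr N borel ((**) Q). (norm (col_proj A u))\<^sup>2)"
      by (simp add: q_def inv[OF Q])
    also have "\<dots> = (LINT A|N. (norm (col_proj (Q ** A) u))\<^sup>2)"
      by (rule integral_distr[OF Q_meas borel_measurable_norm_col_proj])
    also have "\<dots> = q (transpose Q *v u)"
      unfolding q_def col_proj_isometry_mult[OF QQ] matrix_isometry_norm[OF QQ] ..
    finally show ?thesis ..
  qed
  \<comment> \<open>The orthogonal group acts transitively on the unit sphere.\<close>
  have q_unit: "q a = q b" if "norm a = 1" "norm b = 1" for a b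
  proof -
    obtain T where T: "orthogonal_transformation T" "T b = a"
      using orthogonal_transformation_exists_1[of b a] \<open>norm a = 1\<close> \<open>norm b = 1\<close> by metis
    have "orthogonal_matrix (matrix T)" "matrix T *v b = a"
      using T by (auto simp: orthogonal_transformation_matrix orthogonal_transformation_linear matrix_works)
    then have "q (transpose (transpose (matrix T)) *v b) = q b"
      by (intro q_orthogonal) (simp add: orthogonal_matrix_transpose)
    then show ?thesis using \<open>matrix T *v b = a\<close> by (simp only: transpose_transpose)
  qed
  have q_axis: "q u = (norm u)\<^sup>2 * q (axis i 1)" for u i
  proof (cases "u = 0")
    case True
    have "q 0 = 0" using q_scale[of 0 0] by simp
    then show ?thesis using True by simp
  next
    case False
    have "q u = q (norm u *\<^sub>R (u /\<^sub>R norm u))" using False by simp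
    also have "\<dots> = (norm u)\<^sup>2 * q (u /\<^sub>R norm u)" by (rule q_scale)
    also have "q (u /\<^sub>R norm u) = q (axis i 1)"
      using False by (intro q_unit) auto
    finally show ?thesis .
  qed
  \<comment> \<open>The expected trace of the projection is its expected rank, which is full almost
    surely.\<close>
  have "(\<Sum>i\<in>UNIV. q (axis i 1)) = (LINT A|N. real (rank A))"
    unfolding q_def by (simp add: integrable flip: sum_norm_col_proj_axis)
  also have "\<dots> = (LINT A|N. real CARD('k))"
    by (rule integral_cong_AE) (use inj in \<open>auto simp: full_rank_injective\<close>)
  also have "\<dots> = real CARD('k)" by (simp add: prob_space)
  finally have sum_q: "(\<Sum>i\<in>UNIV. q (axis i 1)) = real CARD('k)" .
  define i :: 'm where "i = undefined"
  have "(\<Sum>j\<in>UNIV. q (axis j 1)) = (\<Sum>j\<in>(UNIV :: 'm set). q (axis i 1))"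
    by (intro sum.cong refl q_unit) auto
  then have "q (axis i 1) = real CARD('k) / real CARD('m)"
    using sum_q by (simp add: field_simps)
  then show ?thesis
    using q_axis[of u i] by (simp add: q_def)
qed

text \<open>Independence of the generated sigma-algebras is the product formula on rectangles, and
  rectangles determine the joint law. This is what allows Fubini to freeze the sketch while
  integrating over a random design.\<close>

lemma distr_Pair_indep_rv:
  fixes A :: "'w \<Rightarrow> 'a::topological_space" and B :: "'w \<Rightarrow> 'b::topological_space"
  assumes M: "prob_space M" and indep: "indep_rv M A B"
  shows "distr M (borel \<Otimes>\<^sub>M borel) (\<lambda>\<omega>. (A \<omega>, B \<omega>)) = distr M borel A \<Otimes>\<^sub>M distr M borel B"
proof -
  interpret prob_space M by fact
  have [measurable]: "A \<in> borel_measurable M" "B \<in> borel_measurable M"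
    and set: "indep_set (sets (vimage_algebra (space M) A borel)) (sets (vimage_algebra (space M) B borel))"
    using indep by (auto simp: indep_rv_def)
  show ?thesis
  proof (rule pair_measure_eqI[symmetric])
    show "sigma_finite_measure (distr M borel A)" "sigma_finite_measure (distr M borel B)"
      by (auto intro!: prob_space_imp_sigma_finite prob_space_distr)
    show "sets (distr M borel A \<Otimes>\<^sub>M distr M borel B)
        = sets (distr M (borel \<Otimes>\<^sub>M borel) (\<lambda>\<omega>. (A \<omega>, B \<omega>)))"
      by (simp cong: sets_pair_measure_cong)
    fix S T assume "S \<in> sets (distr M borel A)" "T \<in> sets (distr M borel B)"
    then have [measurable]: "S \<in> sets borel" "T \<in> sets borel" by auto
    have "prob ((A -` S \<inter> space M) \<inter> (B -` T \<inter> space M))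
        = prob (A -` S \<inter> space M) * prob (B -` T \<inter> space M)"
      by (rule indep_setD[OF set]) (auto intro: in_vimage_algebra)
    moreover have "(A -` S \<inter> space M) \<inter> (B -` T \<inter> space M) = (\<lambda>\<omega>. (A \<omega>, B \<omega>)) -` (S \<times> T) \<inter> space M"
      by auto
    ultimately show "emeasure (distr M borel A) S * emeasure (distr M borel B) T
        = emeasure (distr M (borel \<Otimes>\<^sub>M borel) (\<lambda>\<omega>. (A \<omega>, B \<omega>))) (S \<times> T)"
      by (simp add: emeasure_distr emeasure_eq_measure ennreal_mult)
  qed
qed

subsection \<open>Designs with flat spectrum\<close>

lemma matrix_eq_0_imp_inj:
  assumes "\<And>w. A *v w = 0 \<Longrightarrow> w = 0"
  shows "inj ((*v) (A :: real^'k^'m))"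
proof (rule injI)
  fix x y assume "A *v x = A *v y"
  then have "A *v (x - y) = 0" by (simp add: matrix_vector_mult_diff_distrib)
  then show "x = y" using assms by fastforce
qed

lemma inj_matrix_isometry:
  assumes "transpose Q ** Q = mat 1"
  shows "inj ((*v) (Q :: real^'m^'n))"
  using assms matrix_left_invertible_injective by blast

lemma transpose_isometry_mult:
  "transpose Q ** Q = mat 1 \<Longrightarrow> transpose Q *v (Q *v w) = (w :: real^'m)"
  by (simp only: matrix_vector_mul_assoc matrix_vector_mul_lid)

lemma exists_inj:
  assumes "CARD('a) \<le> CARD('b)"
  obtains h :: "'a::finite \<Rightarrow> 'b::finite" where "inj h"
  using card_le_inj[of "UNIV :: 'a set" "UNIV :: 'b set"] assms by auto

lemma sampling_matrix_nth: "sampling_matrix h $ i $ j = of_bool (i = h j)"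
  by (simp add: sampling_matrix_def)

lemma matrix_mult_sampling_matrix: "(A ** sampling_matrix h) $ r $ j = A $ r $ h j"
  by (simp add: matrix_matrix_mult_def sampling_matrix_def if_distrib[of "(*) _"] cong: if_cong)

lemma sampling_matrix_mult_vec: "inj h \<Longrightarrow> (sampling_matrix h *v w) $ h j = w $ j"
  by (simp add: matrix_vector_mult_def sampling_matrix_def inj_eq if_distrib[of "\<lambda>x. x * _"] cong: if_cong)

lemma sampling_matrix_mult_vec_eq_0: "i \<notin> range h \<Longrightarrow> (sampling_matrix h *v w) $ i = 0"
  by (auto simp: matrix_vector_mult_def sampling_matrix_def intro!: sum.neutral)

lemma inj_sampling_matrix: "inj h \<Longrightarrow> inj ((*v) (sampling_matrix h))"
  by (rule matrix_eq_0_imp_inj) (metis sampling_matrix_mult_vec vec_eq_iff zero_index)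

text \<open>The common form of a Gaussian sketch seen through V^T and a Gaussian design times a
  fixed sketch: a linear image \<open>L\<close> such that rotations of the image lift to rotations
  of the Gaussian matrix. A single injective value \<open>L x0\<close> secures full rank almost
  surely.\<close>

lemma gaussian_mean_norm_col_proj:
  fixes A :: "'w \<Rightarrow> real^'c^'r" and L :: "real^'c^'r \<Rightarrow> real^'k^'m"
  assumes A: "prob_space M" "iid_normal_matrix M v A" "v > 0"
    and L: "linear L" "inj ((*v) (L x0))"
    and equivariant: "\<And>Q. orthogonal_matrix Q \<Longrightarrow> \<exists>Q'. orthogonal_matrix Q' \<and> (\<forall>x. Q ** L x = L (Q' ** x))"
  shows "AE x in distr M borel A. inj ((*v) (L x))"
    and "(LINT x|distr M borel A. (norm (col_proj (L x) u))\<^sup>2) = real CARD('k) / real CARD('m) * (norm u)\<^sup>2"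
proof -
  interpret prob_space M by fact
  have [measurable]: "A \<in> borel_measurable M"
    by (rule borel_measurable_iid_normal_matrix[OF A(1,2)])
  have [measurable]: "L \<in> borel_measurable borel"
    by (rule borel_measurable_linear[OF L(1)])
  let ?D = "distr M borel A"
  interpret D: prob_space ?D by (rule prob_space_distr) simp
  show inj: "AE x in ?D. inj ((*v) (L x))"
    by (rule AE_iid_normal_matrix[OF A AE_lborel_inj_linear[OF L]])
  have L_D: "L \<in> measurable ?D borel" by simp
  let ?N = "distr ?D borel L"
  have "(LINT B|?N. (norm (col_proj B u))\<^sup>2) = real CARD('k) / real CARD('m) * (norm u)\<^sup>2"
  proof (rule rotation_invariant_mean_norm_col_proj)
    show "prob_space ?N" by (rule D.prob_space_distr[OF L_D])
    show "AE B in ?N. inj ((*v) B)"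
      using inj by (subst AE_distr_iff[OF L_D]) (simp_all add: sets_inj_matrix)
    fix Q :: "real^'m^'m" assume "orthogonal_matrix Q"
    then obtain Q' where Q': "orthogonal_matrix Q'" "\<And>x. Q ** L x = L (Q' ** x)"
      using equivariant by blast
    have meas: "(**) Q \<in> borel_measurable (borel :: (real^'k^'m) measure)"
      "(**) Q' \<in> borel_measurable (borel :: (real^'c^'r) measure)"
      by (simp_all add: borel_measurable_linear linear_matrix_mult)
    have "distr ?N borel ((**) Q) = distr ?D borel ((**) Q \<circ> L)"
      by (rule distr_distr[OF meas(1) L_D])
    also have "(**) Q \<circ> L = L \<circ> (**) Q'"
      by (simp add: fun_eq_iff Q'(2))
    also have "distr ?D borel (L \<circ> (**) Q') = distr (distr ?D borel ((**) Q')) borel L"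
      using meas(2) by (intro distr_distr[symmetric]) simp_all
    also have "\<dots> = ?N" by (simp only: distr_iid_normal_matrix_orthogonal[OF A Q'(1)])
    finally show "distr ?N borel ((**) Q) = ?N" .
  qed simp
  then show "(LINT x|?D. (norm (col_proj (L x) u))\<^sup>2) = real CARD('k) / real CARD('m) * (norm u)\<^sup>2"
    by (subst (asm) integral_distr[OF L_D borel_measurable_norm_col_proj])
qed

section \<open>Gaussian sketches restricted to the row space of the design\<close>

lemma matrix_diff_ldistrib: "A ** (B - C) = A ** B - A ** (C :: real^'k^'m)"
  and matrix_diff_rdistrib: "(E - F) ** C = E ** C - F ** C"
  and matrix_add_rdistrib: "(E + F) ** C = E ** C + F ** C"
  by (simp_all add: vec_eq_iff matrix_matrix_mult_def algebra_simps sum.distrib sum_subtractf)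

lemma orthogonal_matrix_extension:
  fixes V :: "real^'r^'d" and Q :: "real^'r^'r"
  assumes V: "transpose V ** V = mat 1" and Q: "orthogonal_matrix Q"
  obtains Q' where "orthogonal_matrix Q'" "transpose V ** Q' = Q ** transpose V"
proof
  let ?P = "V ** transpose V"
  \<comment> \<open>\<open>Q\<close> transported to the column space of \<open>V\<close>, together
    with the identity on its orthogonal complement. A rotation of V^T R thus becomes a rotation of
    R.\<close>
  let ?Q' = "V ** Q ** transpose V + (mat 1 - ?P)"
  note mult = matrix_add_ldistrib matrix_add_rdistrib matrix_diff_ldistrib matrix_diff_rdistrib
  have VV: "transpose V ** (V ** X) = X" for X :: "real^'x^'r"
    by (simp add: matrix_mul_assoc V)
  have QQ: "transpose Q ** (Q ** X) = X" for X :: "real^'x^'r"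
    using Q by (simp add: matrix_mul_assoc orthogonal_matrix_def)
  show "transpose V ** ?Q' = Q ** transpose V"
    by (simp add: mult VV flip: matrix_mul_assoc)
  have "transpose ?Q' = V ** transpose Q ** transpose V + (mat 1 - ?P)"
  proof -
    have "transpose ?Q' = transpose (V ** Q ** transpose V) + (mat 1 - transpose ?P)"
      by (simp add: transpose_def vec_eq_iff mat_def eq_commute)
    then show ?thesis by (simp only: matrix_transpose_mul matrix_mul_assoc transpose_transpose)
  qed
  then have "transpose ?Q' ** ?Q' = mat 1"
    by (simp add: mult VV QQ flip: matrix_mul_assoc)
  then show "orthogonal_matrix ?Q'" by (simp add: orthogonal_matrix)
qed

lemma gaussian_mean_norm_col_proj_coisometry:
  fixes R :: "'w \<Rightarrow> real^'k^'d" and V :: "real^'r^'d"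
  assumes R: "prob_space M" "iid_normal_matrix M v R" "v > 0"
    and V: "transpose V ** V = mat 1" and card: "CARD('k) \<le> CARD('r)"
  shows "AE \<omega> in M. inj ((*v) (transpose V ** R \<omega>))"
    and "(LINT \<omega>|M. (norm (col_proj (transpose V ** R \<omega>) u))\<^sup>2)
      = real CARD('k) / real CARD('r) * (norm u)\<^sup>2"
proof -
  have R_meas [measurable]: "R \<in> borel_measurable M"
    by (rule borel_measurable_iid_normal_matrix[OF R(1,2)])
  let ?L = "(**) (transpose V) :: real^'k^'d \<Rightarrow> real^'k^'r"
  have L_meas: "?L \<in> borel_measurable borel"
    by (rule borel_measurable_linear[OF linear_matrix_mult])
  obtain h :: "'k \<Rightarrow> 'r" where h: "inj h" using exists_inj[OF card] by blast
  \<comment> \<open>As V^T V = 1, the witness \<open>V ** sampling_matrix h\<close> is mapped to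
    \<open>sampling_matrix h\<close> itself.\<close>
  have x0: "inj ((*v) (?L (V ** sampling_matrix h)))"
    by (simp add: matrix_mul_assoc V inj_sampling_matrix[OF h])
  have eq: "\<exists>Q'. orthogonal_matrix Q' \<and> (\<forall>x. Q ** ?L x = ?L (Q' ** x))" if "orthogonal_matrix Q" for Q
    using orthogonal_matrix_extension[OF V that] by (metis matrix_mul_assoc)
  note * = gaussian_mean_norm_col_proj[OF R linear_matrix_mult x0 eq]
  have [measurable]: "{x. inj ((*v) (?L x))} \<in> sets borel"
    using measurable_sets[OF L_meas sets_inj_matrix] by (simp add: vimage_def)
  show "AE \<omega> in M. inj ((*v) (transpose V ** R \<omega>))"
    using *(1) AE_distr_iff[OF R_meas, of "\<lambda>x. inj ((*v) (?L x))"] by simp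
  have meas: "(\<lambda>x. (norm (col_proj (?L x) u))\<^sup>2) \<in> borel_measurable borel"
    by (rule measurable_compose[OF L_meas borel_measurable_norm_col_proj])
  show "(LINT \<omega>|M. (norm (col_proj (transpose V ** R \<omega>) u))\<^sup>2)
      = real CARD('k) / real CARD('r) * (norm u)\<^sup>2"
    using *(2)[of u] by (simp only: integral_distr[OF R_meas meas])
qed

lemma borel_measurable_matrix_mult:
  "(\<lambda>p :: (real^'d^'n) \<times> (real^'k^'d). fst p ** snd p) \<in> borel_measurable borel"
  by (intro borel_measurable_continuous_onI) (auto simp: matrix_matrix_mult_def intro!: continuous_intros)

lemma borel_measurable_excess_risk:
  assumes "prob_space M" "white_noise M \<sigma> \<xi>"
  shows "(\<lambda>p :: (real^'d^'n) \<times> (real^'k^'d). excess_risk M \<xi> f (fst p) (snd p)) \<in> borel_measurable borel"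
proof -
  have fst: "fst \<in> borel_measurable (borel :: ((real^'d^'n) \<times> (real^'k^'d)) measure)"
    by (intro borel_measurable_continuous_onI continuous_intros)
  show ?thesis
    unfolding excess_risk_eq[OF assms]
    by (intro borel_measurable_divide borel_measurable_add borel_measurable_diff borel_measurable_times
        borel_measurable_const measurable_compose[OF fst borel_measurable_norm_col_proj]
        measurable_compose[OF borel_measurable_matrix_mult borel_measurable_norm_col_proj]
        measurable_compose[OF borel_measurable_matrix_mult borel_measurable_rank])
qed

section \<open>Excess risk when all singular values equal c, that is, X = c U V^T\<close>

context
  fixes X :: "real^'d^'n" and U :: "real^('r::{finite,linorder})^'n" and s V c
  assumes svd: "thin_svd X U s V" and flat: "\<And>i. s $ i = c" and c: "c > 0"
begin

lemma flat_svd_isometry: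
  shows "transpose U ** U = mat 1" "transpose V ** V = mat 1"
  using svd by (auto simp: thin_svd_def)

lemma flat_svd_mult: "X *v w = c *\<^sub>R (U *v (transpose V *v w))"
proof -
  have "(\<chi> i j. if i = j then s $ i else 0) = c *\<^sub>R mat 1"
    by (simp add: vec_eq_iff mat_def flat)
  then have "X = U ** (c *\<^sub>R mat 1) ** transpose V"
    using svd unfolding thin_svd_def by simp
  then have "X = (c *\<^sub>R U) ** transpose V"
    by (simp add: matrix_mult_scaleR)
  then show ?thesis
    by (simp only: matrix_vector_mul_assoc[symmetric] scaleR_matrix_vector_assoc[symmetric])
qed

text \<open>The residual of \<open>f\<close> is orthogonal to the columns of \<open>U\<close>, since
  X V = c U. Hence U^T f = U^T X w* = c V^T w*, which expresses the vector \<open>alpha_star\<close>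
  through \<open>f\<close> alone.\<close>

lemma flat_svd_alpha_star: "c *\<^sub>R alpha_star V X f = transpose U *v f"
proof -
  have "(transpose U *v (f - col_proj X f)) \<bullet> w = 0" for w
  proof -
    have "X *v (V *v w) = c *\<^sub>R (U *v w)"
      unfolding flat_svd_mult transpose_isometry_mult[OF flat_svd_isometry(2)] ..
    then have "(f - col_proj X f) \<bullet> (U *v w) = 0"
      using col_proj_orthogonal[of f X "V *v w"] c by simp
    then show ?thesis by (simp only: inner_matrix_transpose)
  qed
  then have "transpose U *v (f - col_proj X f) = 0"
    using inner_eq_zero_iff by blast
  then have "transpose U *v f = transpose U *v (X *v w_star X f)"
    by (simp only: mult_w_star matrix_vector_mult_diff_distrib right_minus_eq)
  also have "\<dots> = c *\<^sub>R (transpose V *v w_star X f)"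
    unfolding flat_svd_mult matrix_vector_mult_scaleR transpose_isometry_mult[OF flat_svd_isometry(1)] ..
  finally show ?thesis by (simp only: alpha_star_def)
qed

text \<open>The nonzero factor \<open>c\<close> does not affect column spaces and the isometry
  \<open>U\<close> drops out of all norms, so the risk only depends on how
  \<open>transpose V ** B\<close> projects the coefficient vector.\<close>

lemma flat_svd_excess_risk:
  fixes B :: "real^'k^'d"
  assumes M: "prob_space M" "white_noise M \<sigma> \<xi>" and inj: "inj ((*v) (transpose V ** B))"
  shows "excess_risk M \<xi> f X B = (c\<^sup>2 * (norm (alpha_star V X f))\<^sup>2
    - (norm (col_proj (transpose V ** B) (c *\<^sub>R alpha_star V X f)))\<^sup>2 + \<sigma>\<^sup>2 * real CARD('k)) / real CARD('n)"
proof -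
  let ?C = "transpose V ** B"
  have range: "range ((*v) (X ** B)) = range ((*v) (U ** ?C))"
  proof -
    have "(X ** B) *v w = (U ** ?C) *v (c *\<^sub>R w)" for w
      by (simp only: matrix_vector_mul_assoc[symmetric] flat_svd_mult matrix_vector_mult_scaleR)
    moreover have "range (\<lambda>w :: real^'k. (U ** ?C) *v (c *\<^sub>R w)) = range ((*v) (U ** ?C))"
    proof safe
      fix w
      have "(U ** ?C) *v w = (U ** ?C) *v (c *\<^sub>R (w /\<^sub>R c))" using c by simp
      then show "(U ** ?C) *v w \<in> range (\<lambda>w. (U ** ?C) *v (c *\<^sub>R w))" by (rule range_eqI)
    qed auto
    ultimately show ?thesis by simp
  qed
  have "rank (X ** B) = rank (U ** ?C)"
    unfolding rank_dim_range by (simp only: range)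
  also have "\<dots> = CARD('k)"
    unfolding full_rank_injective
    by (intro inj_matrix_mult inj inj_matrix_isometry flat_svd_isometry)
  finally have rank: "rank (X ** B) = CARD('k)" .
  have "norm (col_proj (X ** B) f) = norm (col_proj ?C (c *\<^sub>R alpha_star V X f))"
    unfolding col_proj_range_cong[OF range] col_proj_isometry_mult[OF flat_svd_isometry(1)]
      matrix_isometry_norm[OF flat_svd_isometry(1)] flat_svd_alpha_star ..
  moreover have "norm (col_proj X f) = c * norm (alpha_star V X f)"
  proof -
    have "col_proj X f = c *\<^sub>R (U *v alpha_star V X f)"
      by (simp only: mult_w_star[symmetric] flat_svd_mult alpha_star_def)
    then show ?thesis using c by (simp add: matrix_isometry_norm[OF flat_svd_isometry(1)])
  qed
  ultimately show ?thesis
    by (simp add: excess_risk_eq[OF M] rank power_mult_distrib)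
qed

text \<open>Here \<open>p\<close> is the expected fraction of the squared signal norm kept by the
  sketch. It is demanded for the one vector that matters and not for all directions, because for
  sampling in (ii) it is computed only along a special axis.\<close>

lemma flat_svd_mean_excess_risk:
  fixes B :: "'w \<Rightarrow> real^'k^'d"
  assumes M: "prob_space M" "white_noise M \<sigma> \<xi>" and B: "B \<in> borel_measurable M"
    and inj: "AE \<omega> in M. inj ((*v) (transpose V ** B \<omega>))"
    and mean: "(LINT \<omega>|M. (norm (col_proj (transpose V ** B \<omega>) (c *\<^sub>R alpha_star V X f)))\<^sup>2)
      = p * (norm (c *\<^sub>R alpha_star V X f))\<^sup>2"
  shows "(LINT \<omega>|M. excess_risk M \<xi> f X (B \<omega>))
    = (c\<^sup>2 * (norm (alpha_star V X f))\<^sup>2 * (1 - p) + \<sigma>\<^sup>2 * real CARD('k)) / real CARD('n)"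
proof -
  interpret prob_space M by fact
  note [measurable] = B
  let ?u = "c *\<^sub>R alpha_star V X f"
  have VB: "(\<lambda>\<omega>. transpose V ** B \<omega>) \<in> borel_measurable M"
    by (rule measurable_compose[OF B borel_measurable_linear[OF linear_matrix_mult]])
  have meas: "(\<lambda>\<omega>. (norm (col_proj (transpose V ** B \<omega>) ?u))\<^sup>2) \<in> borel_measurable M"
    by (rule measurable_compose[OF VB borel_measurable_norm_col_proj])
  have int: "integrable M (\<lambda>\<omega>. (norm (col_proj (transpose V ** B \<omega>) ?u))\<^sup>2)"
    by (rule integrable_const_bound[OF _ meas, of "(norm ?u)\<^sup>2"]) (simp del: norm_scaleR add: norm_col_proj_le)
  have "(\<lambda>\<omega>. (X, B \<omega>)) \<in> measurable M borel"
    unfolding borel_prod[symmetric] by measurable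
  from measurable_compose[OF this borel_measurable_excess_risk[OF M]]
  have "(\<lambda>\<omega>. excess_risk M \<xi> f X (B \<omega>)) \<in> borel_measurable M" by simp
  then have "(LINT \<omega>|M. excess_risk M \<xi> f X (B \<omega>))
    = (LINT \<omega>|M. (c\<^sup>2 * (norm (alpha_star V X f))\<^sup>2
      - (norm (col_proj (transpose V ** B \<omega>) ?u))\<^sup>2 + \<sigma>\<^sup>2 * real CARD('k)) / real CARD('n))"
    using inj meas by (intro integral_cong_AE) (auto simp: flat_svd_excess_risk[OF M])
  also have "\<dots> = (c\<^sup>2 * (norm (alpha_star V X f))\<^sup>2 - p * (norm ?u)\<^sup>2 + \<sigma>\<^sup>2 * real CARD('k)) / real CARD('n)"
    by (simp add: int mean prob_space)
  finally show ?thesis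
    by (simp add: power_mult_distrib algebra_simps)
qed

end

text \<open>The row and column index types are different although equally large, so the argument
  passes through surjectivity: every vector is of the form V w, and V V^T fixes it.\<close>

lemma isometry_transpose_square:
  fixes V :: "real^'r^'d"
  assumes "transpose V ** V = mat 1" "CARD('r) = CARD('d)"
  shows "V ** transpose V = mat 1"
proof -
  have "rank V = CARD('d)"
    using inj_matrix_isometry[OF assms(1)] assms(2) by (simp add: full_rank_injective[symmetric])
  then have "surj ((*v) V)" by (simp add: full_rank_surjective)
  have "(V ** transpose V) *v x = mat 1 *v x" for x
  proof -
    obtain w where "x = V *v w" using \<open>surj ((*v) V)\<close> by (metis surjD)
    then show ?thesis
      by (simp add: assms(1) matrix_vector_mul_assoc flip: matrix_mul_assoc)
  qed
  then show ?thesis unfolding matrix_eq by blast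
qed

subsection \<open>Column sampling\<close>

lemma
  fixes S :: "'w \<Rightarrow> real^'k^'d"
  assumes M: "prob_space M" and S: "uniform_column_sampling M S" and card: "CARD('k) \<le> CARD('d)"
  shows AE_uniform_column_sampling: "AE \<omega> in M. \<exists>h. inj h \<and> S \<omega> = sampling_matrix h"
    and integral_uniform_column_sampling: "(LINT \<omega>|M. g (S \<omega>))
      = (\<Sum>h \<in> {h :: 'k \<Rightarrow> 'd. inj h}. g (sampling_matrix h)) / real (card {h :: 'k \<Rightarrow> 'd. inj h})"
proof -
  obtain \<iota> :: "'w \<Rightarrow> 'k \<Rightarrow> 'd" where \<iota>: "\<iota> \<in> measurable M (count_space UNIV)"
    "distr M (count_space UNIV) \<iota> = measure_pmf (pmf_of_set {h. inj h})"
    "\<And>\<omega>. \<omega> \<in> space M \<Longrightarrow> S \<omega> = sampling_matrix (\<iota> \<omega>)"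
    using S by (auto simp: uniform_column_sampling_def)
  have ne: "{h :: 'k \<Rightarrow> 'd. inj h} \<noteq> {}"
    using exists_inj[OF card] by blast
  have "AE h in distr M (count_space UNIV) \<iota>. inj h"
    unfolding \<iota>(2) using ne by (simp add: AE_measure_pmf_iff)
  then have "AE \<omega> in M. inj (\<iota> \<omega>)"
    by (subst (asm) AE_distr_iff[OF \<iota>(1)]) simp_all
  then show "AE \<omega> in M. \<exists>h. inj h \<and> S \<omega> = sampling_matrix h"
    by (rule AE_mp) (auto intro!: AE_I2 simp: \<iota>(3))
  have "(LINT \<omega>|M. g (S \<omega>)) = (LINT \<omega>|M. g (sampling_matrix (\<iota> \<omega>)))"
    by (intro Bochner_Integration.integral_cong) (auto simp: \<iota>(3))
  also have "\<dots> = (LINT h|distr M (count_space UNIV) \<iota>. g (sampling_matrix h))"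
    by (rule integral_distr[OF \<iota>(1), symmetric]) simp
  also have "\<dots> = (\<Sum>h \<in> {h :: 'k \<Rightarrow> 'd. inj h}. g (sampling_matrix h)) / real (card {h :: 'k \<Rightarrow> 'd. inj h})"
    unfolding \<iota>(2) using ne by (intro integral_pmf_of_set) simp_all
  finally show "(LINT \<omega>|M. g (S \<omega>))
      = (\<Sum>h \<in> {h :: 'k \<Rightarrow> 'd. inj h}. g (sampling_matrix h)) / real (card {h :: 'k \<Rightarrow> 'd. inj h})" .
qed

text \<open>Double counting of pairs of an injection and a point in its range. Composition with a
  transposition shows that all points are hit equally often, so each index is sampled with
  probability k/d.\<close>

lemma card_inj_range:
  fixes i :: "'d::finite"
  shows "real (card {h :: 'k::finite \<Rightarrow> 'd. inj h \<and> i \<in> range h}) * real CARD('d)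
    = real CARD('k) * real (card {h :: 'k \<Rightarrow> 'd. inj h})"
proof -
  let ?I = "{h :: 'k \<Rightarrow> 'd. inj h}"
  define N where "N i = {h :: 'k \<Rightarrow> 'd. inj h \<and> i \<in> range h}" for i
  have le: "card (N i) \<le> card (N j)" for i j
  proof (rule card_inj_on_le)
    let ?t = "Transposition.transpose i j"
    have bij: "bij ?t" by simp
    show "inj_on ((\<circ>) ?t) (N i)"
      by (rule inj_on_subset[of _ UNIV]) (auto simp: inj_def fun_eq_iff bij_is_inj[OF bij, THEN inj_eq])
    show "(\<circ>) ?t ` N i \<subseteq> N j"
    proof safe
      fix h assume "h \<in> N i"
      then obtain a where "inj h" "i = h a" by (auto simp: N_def)
      then show "?t \<circ> h \<in> N j"
        using bij by (auto simp: N_def bij_is_inj inj_compose intro!: range_eqI[of _ _ a])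
    qed
  qed simp
  have "(\<Sum>j\<in>UNIV. real (card (N j))) = (\<Sum>j\<in>UNIV. \<Sum>h\<in>?I. of_bool (j \<in> range h))"
    by (intro sum.cong refl) (simp add: N_def Collect_conj_eq[symmetric])
  also have "\<dots> = (\<Sum>h\<in>?I. real (card (range h)))"
    by (subst sum.swap) simp
  also have "\<dots> = (\<Sum>h\<in>?I. real CARD('k))"
    by (intro sum.cong refl) (simp add: card_image)
  also have "\<dots> = real CARD('k) * real (card ?I)" by simp
  also have "(\<Sum>j\<in>UNIV. real (card (N j))) = (\<Sum>j\<in>(UNIV :: 'd set). real (card (N i)))"
    by (intro sum.cong refl arg_cong[of _ _ real] antisym le)
  finally show ?thesis by (simp add: N_def mult.commute)
qed

text \<open>A quantity additive over the sampled indices has a mean determined by the inclusion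
  probability k/d of single indices. In (i) the weights are squared coordinates; in (ii) a single
  index carries all the weight.\<close>

lemma mean_uniform_column_sampling_range:
  fixes S :: "'w \<Rightarrow> real^'k^'d"
  assumes M: "prob_space M" and S: "uniform_column_sampling M S" and card: "CARD('k) \<le> CARD('d)"
    and g: "\<And>h. inj h \<Longrightarrow> g (sampling_matrix h) = (\<Sum>i\<in>UNIV. of_bool (i \<in> range h) * a i)"
  shows "(LINT \<omega>|M. g (S \<omega>)) = real CARD('k) / real CARD('d) * (\<Sum>i\<in>UNIV. a i)"
proof -
  let ?I = "{h :: 'k \<Rightarrow> 'd. inj h}"
  have "?I \<noteq> {}" using exists_inj[OF card] by blast
  then have pos: "real (card ?I) > 0" by (simp add: card_gt_0_iff)
  have freq: "(\<Sum>h\<in>?I. of_bool (i \<in> range h)) = real CARD('k) / real CARD('d) * real (card ?I)" for i :: 'd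
    using card_inj_range[where 'k='k and i = i]
    by (simp add: Collect_conj_eq[symmetric] field_simps)
  have "(\<Sum>h\<in>?I. g (sampling_matrix h)) = (\<Sum>h\<in>?I. \<Sum>i\<in>UNIV. of_bool (i \<in> range h) * a i)"
    by (intro sum.cong) (simp_all add: g)
  also have "\<dots> = (\<Sum>i\<in>UNIV. (\<Sum>h\<in>?I. of_bool (i \<in> range h)) * a i)"
    by (subst sum.swap) (simp only: sum_distrib_right)
  also have "\<dots> = real CARD('k) / real CARD('d) * real (card ?I) * (\<Sum>i\<in>UNIV. a i)"
    unfolding freq sum_distrib_left ..
  finally have sum_g: "(\<Sum>h\<in>?I. g (sampling_matrix h)) = \<dots>" .
  have "p * c * t / c = p * t" if "c > 0" for p c t :: real using that by simp
  from this[OF pos] show ?thesis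
    unfolding integral_uniform_column_sampling[OF M S card] sum_g .
qed

lemma norm_col_proj_sampling_matrix:
  assumes "inj h"
  shows "(norm (col_proj (sampling_matrix h) w))\<^sup>2 = (\<Sum>i\<in>UNIV. of_bool (i \<in> range h) * (w $ i)\<^sup>2)"
proof -
  let ?p = "\<chi> i. of_bool (i \<in> range h) * w $ i"
  have "?p = sampling_matrix h *v (\<chi> j. w $ h j)"
  proof (simp only: vec_eq_iff vec_lambda_beta, rule)
    fix i
    show "of_bool (i \<in> range h) * w $ i = (sampling_matrix h *v (\<chi> j. w $ h j)) $ i"
      by (cases "i \<in> range h")
        (auto simp: sampling_matrix_mult_vec[OF assms] sampling_matrix_mult_vec_eq_0)
  qed
  moreover have "(w - ?p) \<bullet> (sampling_matrix h *v v) = 0" for v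
    unfolding inner_vec_def
    by (intro sum.neutral) (auto simp: of_bool_def sampling_matrix_mult_vec_eq_0)
  ultimately have "col_proj (sampling_matrix h) w = ?p"
    by (intro col_proj_eqI) auto
  then have "(norm (col_proj (sampling_matrix h) w))\<^sup>2 = ?p \<bullet> ?p"
    by (simp only: power2_norm_eq_inner)
  then show ?thesis
    by (auto simp: inner_vec_def power2_eq_square of_bool_def intro!: sum.cong)
qed

section \<open>Isometries with prescribed range and one prescribed column\<close>

lemma norm_preserving_matrix:
  fixes V :: "real^'r^'d"
  assumes "\<And>x. norm (V *v x) = norm x"
  shows "transpose V ** V = mat 1"
proof -
  have "(V *v x) \<bullet> (V *v y) = x \<bullet> y" for x y
    by (simp add: dot_norm assms flip: matrix_vector_right_distrib)
  then have "x \<bullet> ((transpose V ** V) *v y) = x \<bullet> (mat 1 *v y)" for x y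
    by (simp only: matrix_vector_mul_assoc[symmetric] inner_matrix_transpose[of x "transpose V"]
        transpose_transpose matrix_vector_mul_lid)
  then show ?thesis
    unfolding matrix_eq by (metis vector_eq_ldot)
qed

lemma exists_isometry_onto_subspace:
  fixes T :: "(real^'d) set" and i :: "'r::finite"
  assumes T: "subspace T" "dim T = CARD('r)" and e: "e \<in> T" "norm e = 1"
  obtains V :: "real^'r^'d"
    where "transpose V ** V = mat 1" "range ((*v) V) = T" "V *v axis i 1 = e"
proof -
  have "dim (UNIV :: (real^'r) set) = dim T" by (simp add: T(2))
  then have "\<exists>f g. linear f \<and> f ` (UNIV :: (real^'r) set) = T \<and> (\<forall>x. norm (f x) = norm x) \<and>
      (\<forall>x\<in>T. norm (g x) = norm x) \<and> (\<forall>x\<in>T. f (g x) = x)"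
    by (rule isometries_subspaces[OF subspace_UNIV T(1)]) (metis UNIV_I)
  then obtain f g where f: "linear f" "f ` (UNIV :: (real^'r) set) = T" "\<And>x. norm (f x) = norm x"
    and g: "\<And>x. x \<in> T \<Longrightarrow> norm (g x) = norm x" "\<And>x. x \<in> T \<Longrightarrow> f (g x) = x"
    by metis
  have "norm (g e) = 1" using g(1)[OF e(1)] e(2) by simp
  \<comment> \<open>An isometry onto \<open>T\<close> need not send the chosen axis to
    \<open>e\<close>; a preliminary rotation corrects this without changing the range.\<close>
  then obtain p where p: "orthogonal_transformation p" "p (axis i 1 :: real^'r) = g e"
    using orthogonal_transformation_exists_1[OF norm_axis_1] by blast
  let ?V = "matrix (f \<circ> p)"
  have V: "?V *v x = f (p x)" for x
    using linear_compose[OF orthogonal_transformation_linear[OF p(1)] f(1)]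
    by (simp add: matrix_works)
  have "norm (?V *v x) = norm x" for x
    using p(1) by (simp add: V f(3) orthogonal_transformation)
  then have "transpose ?V ** ?V = mat 1" by (rule norm_preserving_matrix)
  moreover have "range ((*v) ?V) = T"
  proof -
    have "range ((*v) ?V) = f ` range p" by (auto simp: V)
    then show ?thesis using f(2) orthogonal_transformation_surj[OF p(1)] by simp
  qed
  moreover have "?V *v axis i 1 = e"
    by (simp add: V p(2) g(2)[OF e(1)])
  ultimately show thesis by (rule that)
qed

text \<open>Places the sampled columns \<open>h j\<close> into distinct rows so that the
  distinguished column \<open>i\<close>, and no other, occupies the distinguished row
  \<open>r\<close>. If \<open>i\<close> is not sampled, row \<open>r\<close> stays empty, which
  requires a spare row.\<close>

lemma exists_inj_matching:
  fixes h :: "'k::finite \<Rightarrow> 'd::finite" and i :: 'd and r :: "'r::finite"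
  assumes "inj h" and card: "CARD('k) \<le> CARD('r)" "i \<in> range h \<or> CARD('k) < CARD('r)"
  obtains \<kappa> :: "'k \<Rightarrow> 'r" where "inj \<kappa>" "\<And>j. \<kappa> j = r \<longleftrightarrow> h j = i"
proof (cases "i \<in> range h")
  case True
  then obtain j0 where j0: "h j0 = i" by blast
  obtain \<kappa> :: "'k \<Rightarrow> 'r" where "inj \<kappa>" using exists_inj[OF card(1)] by blast
  let ?\<kappa> = "Transposition.transpose (\<kappa> j0) r \<circ> \<kappa>"
  have "inj ?\<kappa>" by (simp add: \<open>inj \<kappa>\<close> inj_compose bij_is_inj)
  moreover have "?\<kappa> j0 = r" by simp
  ultimately have "?\<kappa> j = r \<longleftrightarrow> h j = i" for j
    using j0 \<open>inj h\<close> by (metis injD)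
  with \<open>inj ?\<kappa>\<close> show thesis by (rule that)
next
  case False
  then have "CARD('k) \<le> card (UNIV - {r})" using card by (simp add: card_Diff_singleton)
  then obtain \<kappa> :: "'k \<Rightarrow> 'r" where "range \<kappa> \<subseteq> UNIV - {r}" "inj \<kappa>"
    using card_le_inj[of "UNIV :: 'k set" "UNIV - {r}"] by auto
  with False show thesis by (intro that[of \<kappa>]) auto
qed

subsection \<open>A generic design\<close>

text \<open>A generic subspace of dimension \<open>CARD('r)\<close> that contains a given coordinate axis: the zero
  pattern splits off that axis, and the remaining entries are chosen outside a null set.\<close>

lemma exists_full_spark_isometry:
  fixes d0 :: "'d::finite" and r0 :: "'r::finite"
  assumes card: "CARD('k::finite) < CARD('r)" "CARD('r) \<le> CARD('d)"
  obtains V :: "real^'r^'d" where "transpose V ** V = mat 1" "V *v axis r0 1 = axis d0 1"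
    "\<And>h :: 'k \<Rightarrow> 'd. inj h \<Longrightarrow> inj ((*v) (transpose V ** sampling_matrix h))"
proof -
  \<comment> \<open>\<open>L\<close> clears the row \<open>r0\<close> and the column
    \<open>d0\<close> except at their crossing. Writing the pattern as a linear map lets the null
    set argument run over all matrices \<open>A\<close>.\<close>
  define L :: "real^'d^'r \<Rightarrow> real^'d^'r" where
    "L A = (\<chi> r j. if r = r0 \<longleftrightarrow> j = d0 then A $ r $ j else 0)" for A
  have L_nth: "L A $ r $ j = (if r = r0 \<longleftrightarrow> j = d0 then A $ r $ j else 0)" for A r j
    by (simp add: L_def)
  have lin: "linear L"
    by (rule linearI) (simp_all add: vec_eq_iff L_nth)
  have AE_sampling: "AE A in lborel. \<forall>h \<in> {h :: 'k \<Rightarrow> 'd. inj h}. inj ((*v) (L A ** sampling_matrix h))"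
  proof (rule AE_finite_allI)
    fix h :: "'k \<Rightarrow> 'd" assume "h \<in> {h. inj h}"
    then have h: "inj h" by simp
    obtain \<kappa> :: "'k \<Rightarrow> 'r" where \<kappa>: "inj \<kappa>" "\<And>j. \<kappa> j = r0 \<longleftrightarrow> h j = d0"
      using exists_inj_matching[OF h, of d0 r0] card(1) by (metis less_imp_le)
    \<comment> \<open>Ones at the positions (\<open>\<kappa> j\<close>, \<open>h j\<close>). The
      matching condition on \<open>\<kappa>\<close> ensures that \<open>L\<close> erases none of
      them, so the sampled columns form a sampling matrix.\<close>
    let ?A = "\<chi> r i. of_bool (\<exists>j. h j = i \<and> \<kappa> j = r)"
    have "L ?A ** sampling_matrix h = sampling_matrix \<kappa>"
      using \<kappa>(2)
      by (auto simp: vec_eq_iff matrix_mult_sampling_matrix L_nth sampling_matrix_nth inj_eq[OF h])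
    then have "inj ((*v) (L ?A ** sampling_matrix h))"
      by (simp add: inj_sampling_matrix[OF \<kappa>(1)])
    moreover have "linear (\<lambda>A. L A ** sampling_matrix h)"
      by (rule linearI) (simp_all add: vec_eq_iff matrix_mult_sampling_matrix linear_add[OF lin] linear_scale[OF lin])
    ultimately show "AE A in lborel. inj ((*v) (L A ** sampling_matrix h))"
      by (intro AE_lborel_inj_linear)
  qed simp
  have AE_rank: "AE A in lborel. inj ((*v) (transpose (L A)))"
  proof -
    have lin_transpose: "linear (\<lambda>A. transpose (L A))"
      by (rule linearI) (simp_all add: vec_eq_iff transpose_def linear_add[OF lin] linear_scale[OF lin])
    obtain \<rho>' :: "'r \<Rightarrow> 'd" where "inj \<rho>'" using exists_inj[OF card(2)] by blast
    let ?\<rho> = "Transposition.transpose (\<rho>' r0) d0 \<circ> \<rho>'"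
    have inj: "inj ?\<rho>" by (simp add: \<open>inj \<rho>'\<close> inj_compose bij_is_inj)
    have "?\<rho> r0 = d0" by simp
    then have \<rho>: "?\<rho> r = d0 \<longleftrightarrow> r = r0" for r
      using inj by (metis injD)
    have "transpose (L (\<chi> r i. of_bool (?\<rho> r = i))) = sampling_matrix ?\<rho>"
      using \<rho> by (auto simp: vec_eq_iff transpose_def L_nth sampling_matrix_nth)
    then have "inj ((*v) (transpose (L (\<chi> r i. of_bool (?\<rho> r = i)))))"
      by (simp only: inj_sampling_matrix[OF inj])
    with lin_transpose show ?thesis by (rule AE_lborel_inj_linear)
  qed
  \<comment> \<open>Lebesgue measure is not zero, so a property that holds almost everywhere holds
    for some matrix.\<close>
  have "emeasure lborel (space (lborel :: (real^'d^'r) measure)) \<noteq> 0" by simp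
  then have "\<exists>A. (\<forall>h \<in> {h :: 'k \<Rightarrow> 'd. inj h}. inj ((*v) (L A ** sampling_matrix h))) \<and> inj ((*v) (transpose (L A)))"
    using AE_conjI[OF AE_sampling AE_rank] ae_filter_eq_bot_iff eventually_happens' by blast
  then obtain A where A: "\<And>h :: 'k \<Rightarrow> 'd. inj h \<Longrightarrow> inj ((*v) (L A ** sampling_matrix h))"
    and rank: "inj ((*v) (transpose (L A)))" by blast
  define T where "T = range ((*v) (transpose (L A)))"
  have T: "subspace T" "dim T = CARD('r)"
    unfolding T_def using rank
    by (metis span_columns_eq_range subspace_span, simp only: rank_dim_range[symmetric] full_rank_injective)
  \<comment> \<open>By the zero pattern, row \<open>r0\<close> is a multiple of the axis
    \<open>d0\<close>; the rank condition makes the multiple nonzero, which puts this axis into the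
    row space \<open>T\<close>.\<close>
  have row: "transpose (L A) *v axis r0 1 = (L A $ r0 $ d0) *\<^sub>R axis d0 1"
    unfolding matrix_vector_mult_basis column_transpose
    by (auto simp: vec_eq_iff row_def L_nth axis_def)
  have "L A $ r0 $ d0 \<noteq> 0"
  proof
    assume "L A $ r0 $ d0 = 0"
    then have "transpose (L A) *v axis r0 1 = transpose (L A) *v 0"
      unfolding row by simp
    from injD[OF rank this] show False by simp
  qed
  then have "axis d0 1 = transpose (L A) *v (axis r0 1 /\<^sub>R (L A $ r0 $ d0))"
    unfolding matrix_vector_mult_scaleR row by simp
  then have "axis d0 1 \<in> T" unfolding T_def by (rule range_eqI)
  then obtain V :: "real^'r^'d"
    where V: "transpose V ** V = mat 1" "range ((*v) V) = T" "V *v axis r0 1 = axis d0 1"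
    using exists_isometry_onto_subspace[OF T _ norm_axis_1] by metis
  \<comment> \<open>V^T and \<open>L A\<close> have the same kernel, the orthogonal complement of
    \<open>T\<close>. Independence of sampled columns therefore passes from \<open>L A\<close> to
    V^T.\<close>
  have "inj ((*v) (transpose V ** sampling_matrix h))" if h: "inj h" for h :: "'k \<Rightarrow> 'd"
  proof (rule matrix_eq_0_imp_inj)
    fix w assume "(transpose V ** sampling_matrix h) *v w = 0"
    then have "transpose V *v (sampling_matrix h *v w) = 0"
      by (simp only: matrix_vector_mul_assoc)
    then have orth: "(sampling_matrix h *v w) \<bullet> (V *v x) = 0" for x
      unfolding inner_matrix_transpose by (simp only: inner_zero_left)
    have "x \<bullet> ((L A ** sampling_matrix h) *v w) = 0" for x
    proof -
      obtain z where "transpose (L A) *v x = V *v z"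
        using V(2) unfolding T_def by blast
      then have "(transpose (L A) *v x) \<bullet> (sampling_matrix h *v w) = 0"
        using orth[of z] by (simp only: inner_commute)
      then show ?thesis
        by (simp only: inner_matrix_transpose[symmetric] matrix_vector_mul_assoc[symmetric])
    qed
    then have "(L A ** sampling_matrix h) *v w = (L A ** sampling_matrix h) *v 0"
      by (metis inner_eq_zero_iff matrix_vector_mult_0_right)
    then show "w = 0" using A[OF h] by (metis injD)
  qed
  with V(1,3) show thesis by (rule that)
qed

section \<open>Gaussian designs\<close>

text \<open>The right-hand side does not mention \<open>B\<close>, which is the whole content of
  (iii). The mean of |P_X f|^2 is left unevaluated because it is common to both sketches.\<close>

lemma gaussian_design_mean_excess_risk:
  fixes X :: "'w \<Rightarrow> real^'d^'n" and B :: "'w \<Rightarrow> real^'k^'d"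
  assumes M: "prob_space M" "white_noise M \<sigma> \<xi>" and X: "iid_normal_matrix M 1 X"
    and indep: "indep_rv M X B" and inj: "AE \<omega> in M. inj ((*v) (B \<omega>))"
    and card: "CARD('k) \<le> CARD('n)"
  shows "(LINT \<omega>|M. excess_risk M \<xi> f (X \<omega>) (B \<omega>)) =
    ((LINT \<omega>|M. (norm (col_proj (X \<omega>) f))\<^sup>2) - real CARD('k) / real CARD('n) * (norm f)\<^sup>2
      + \<sigma>\<^sup>2 * real CARD('k)) / real CARD('n)"
proof -
  interpret prob_space M by fact
  have X_meas [measurable]: "X \<in> borel_measurable M" and B_meas [measurable]: "B \<in> borel_measurable M"
    using indep by (auto simp: indep_rv_def)
  let ?DX = "distr M borel X" and ?DB = "distr M borel B"
  interpret DX: prob_space ?DX by (rule prob_space_distr) simp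
  interpret DB: prob_space ?DB by (rule prob_space_distr) simp
  interpret P: pair_prob_space ?DX ?DB ..
  have distr_XB: "distr M (borel \<Otimes>\<^sub>M borel) (\<lambda>\<omega>. (X \<omega>, B \<omega>)) = ?DX \<Otimes>\<^sub>M ?DB"
    by (rule distr_Pair_indep_rv[OF M(1) indep])
  have XB_meas: "(\<lambda>\<omega>. (X \<omega>, B \<omega>)) \<in> measurable M (borel \<Otimes>\<^sub>M borel)" by measurable
  have sets_P: "sets (?DX \<Otimes>\<^sub>M ?DB) = sets (borel \<Otimes>\<^sub>M borel)"
    by (simp cong: sets_pair_measure_cong)
  have mult: "(\<lambda>p :: (real^'d^'n) \<times> (real^'k^'d). fst p ** snd p) \<in> measurable (borel \<Otimes>\<^sub>M borel) borel"
    unfolding borel_prod by (rule borel_measurable_matrix_mult)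
  have gauss: "AE x in ?DX. inj ((*v) (x ** b))"
      "(LINT x|?DX. (norm (col_proj (x ** b) f))\<^sup>2) = real CARD('k) / real CARD('n) * (norm f)\<^sup>2"
    if b: "inj ((*v) b)" for b :: "real^'k^'d"
  proof -
    obtain C where C: "C ** b = mat 1" using b matrix_left_invertible_injective by blast
    obtain h :: "'k \<Rightarrow> 'n" where h: "inj h" using exists_inj[OF card] by blast
    have lin: "linear (\<lambda>x :: real^'d^'n. x ** b)"
      by (rule linearI) (simp_all add: matrix_add_rdistrib scaleR_matrix_mult)
    \<comment> \<open>The left inverse \<open>C\<close> cancels \<open>b\<close>, leaving an
      injective sampling matrix; such a matrix exists because k is at most n.\<close>
    have x0: "inj ((*v) ((sampling_matrix h ** C) ** b))"
      by (simp add: C inj_sampling_matrix[OF h] flip: matrix_mul_assoc)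
    have eq: "\<exists>Q'. orthogonal_matrix Q' \<and> (\<forall>x. Q ** (x ** b) = (Q' ** x) ** b)" if "orthogonal_matrix Q" for Q
      using that by (auto simp: matrix_mul_assoc)
    note * = gaussian_mean_norm_col_proj[OF M(1) X zero_less_one lin x0 eq]
    show "AE x in ?DX. inj ((*v) (x ** b))" by (rule *(1))
    show "(LINT x|?DX. (norm (col_proj (x ** b) f))\<^sup>2) = real CARD('k) / real CARD('n) * (norm f)\<^sup>2"
      by (rule *(2))
  qed
  have inj_DB: "AE b in ?DB. inj ((*v) b)"
    using inj AE_distr_iff[OF B_meas, of "\<lambda>b. inj ((*v) b)"] sets_inj_matrix by simp
  have inj_meas: "{p \<in> space (?DX \<Otimes>\<^sub>M ?DB). inj ((*v) (fst p ** snd p))} \<in> sets (?DX \<Otimes>\<^sub>M ?DB)"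
    using measurable_sets[OF mult sets_inj_matrix]
    by (simp add: sets_P vimage_def space_pair_measure Collect_conj_eq)
  have "AE b in ?DB. AE x in ?DX. inj ((*v) (x ** b))"
    using inj_DB by (rule eventually_mono) (rule gauss(1))
  then have "AE p in ?DX \<Otimes>\<^sub>M ?DB. inj ((*v) (fst p ** snd p))"
    using P.AE_commute[of "\<lambda>x b. inj ((*v) (x ** b))"] P.AE_pair_iff[of "\<lambda>x b. inj ((*v) (x ** b))"] inj_meas
    by simp
  then have inj_XB: "AE \<omega> in M. inj ((*v) (X \<omega> ** B \<omega>))"
    unfolding distr_XB[symmetric]
    using AE_distr_iff[OF XB_meas, of "\<lambda>p. inj ((*v) (fst p ** snd p))"] inj_meas
    by (simp add: sets_P space_pair_measure)
  have q_meas: "(\<lambda>p :: (real^'d^'n) \<times> (real^'k^'d). (norm (col_proj (fst p ** snd p) f))\<^sup>2) \<in> borel_measurable (borel \<Otimes>\<^sub>M borel)"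
    by (rule measurable_compose[OF mult borel_measurable_norm_col_proj])
  have q_int: "integrable (?DX \<Otimes>\<^sub>M ?DB) (\<lambda>p. (norm (col_proj (fst p ** snd p) f))\<^sup>2)"
    using q_meas
    by (intro P.integrable_const_bound[of _ "(norm f)\<^sup>2"])
      (simp_all add: norm_col_proj_le measurable_cong_sets[OF sets_P refl])
  have mean_XB: "(LINT \<omega>|M. (norm (col_proj (X \<omega> ** B \<omega>) f))\<^sup>2) = real CARD('k) / real CARD('n) * (norm f)\<^sup>2"
  proof -
    have "(LINT \<omega>|M. (norm (col_proj (X \<omega> ** B \<omega>) f))\<^sup>2)
        = (LINT p|distr M (borel \<Otimes>\<^sub>M borel) (\<lambda>\<omega>. (X \<omega>, B \<omega>)). (norm (col_proj (fst p ** snd p) f))\<^sup>2)"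
      using integral_distr[OF XB_meas q_meas] by simp
    \<comment> \<open>The sketch is the outer variable: for almost every fixed \<open>b\<close> the
      inner mean over the design is the same constant.\<close>
    also have "\<dots> = (LINT b|?DB. LINT x|?DX. (norm (col_proj (x ** b) f))\<^sup>2)"
      using P.integral_snd[of "\<lambda>x b. (norm (col_proj (x ** b) f))\<^sup>2"] q_int
      by (simp add: distr_XB split_beta')
    also have "\<dots> = (LINT b|?DB. real CARD('k) / real CARD('n) * (norm f)\<^sup>2)"
    proof (rule integral_cong_AE)
      show "(\<lambda>b. LINT x|?DX. (norm (col_proj (x ** b) f))\<^sup>2) \<in> borel_measurable ?DB"
        using P.integrable_snd[of "\<lambda>x b. (norm (col_proj (x ** b) f))\<^sup>2"] q_int
        by (simp add: split_beta' borel_measurable_integrable)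
      show "AE b in ?DB. (LINT x|?DX. (norm (col_proj (x ** b) f))\<^sup>2) = real CARD('k) / real CARD('n) * (norm f)\<^sup>2"
        using inj_DB by (rule eventually_mono) (rule gauss(2))
    qed simp
    also have "\<dots> = real CARD('k) / real CARD('n) * (norm f)\<^sup>2" using DB.prob_space by simp
    finally show ?thesis .
  qed
  have X_int: "integrable M (\<lambda>\<omega>. (norm (col_proj (X \<omega>) f))\<^sup>2)"
    by (rule integrable_const_bound[of _ "(norm f)\<^sup>2"])
      (simp_all add: norm_col_proj_le measurable_compose[OF X_meas borel_measurable_norm_col_proj])
  have XB_int: "integrable M (\<lambda>\<omega>. (norm (col_proj (X \<omega> ** B \<omega>) f))\<^sup>2)"
    using measurable_compose[OF XB_meas q_meas]
    by (intro integrable_const_bound[of _ "(norm f)\<^sup>2"]) (simp_all add: norm_col_proj_le)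
  have "(LINT \<omega>|M. excess_risk M \<xi> f (X \<omega>) (B \<omega>)) =
    (LINT \<omega>|M. ((norm (col_proj (X \<omega>) f))\<^sup>2 - (norm (col_proj (X \<omega> ** B \<omega>) f))\<^sup>2 + \<sigma>\<^sup>2 * real CARD('k)) / real CARD('n))"
  proof (rule integral_cong_AE)
    show "(\<lambda>\<omega>. excess_risk M \<xi> f (X \<omega>) (B \<omega>)) \<in> borel_measurable M"
      using measurable_compose[OF XB_meas[unfolded borel_prod] borel_measurable_excess_risk[OF M]] by simp
    show "(\<lambda>\<omega>. ((norm (col_proj (X \<omega>) f))\<^sup>2 - (norm (col_proj (X \<omega> ** B \<omega>) f))\<^sup>2 + \<sigma>\<^sup>2 * real CARD('k)) / real CARD('n))
        \<in> borel_measurable M"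
      using borel_measurable_integrable[OF X_int] borel_measurable_integrable[OF XB_int] by measurable
    show "AE \<omega> in M. excess_risk M \<xi> f (X \<omega>) (B \<omega>) =
        ((norm (col_proj (X \<omega>) f))\<^sup>2 - (norm (col_proj (X \<omega> ** B \<omega>) f))\<^sup>2 + \<sigma>\<^sup>2 * real CARD('k)) / real CARD('n)"
      using inj_XB by (rule eventually_mono) (simp add: excess_risk_eq[OF M] full_rank_injective[THEN iffD2])
  qed
  then show ?thesis
    by (simp add: X_int XB_int mean_XB prob_space)
qed

lemma flat_svd_mean_excess_risk_gaussian:
  fixes X :: "real^'d^'n" and U :: "real^('r::{finite,linorder})^'n" and R :: "'w \<Rightarrow> real^'k^'d"
  assumes svd: "thin_svd X U s V" "\<And>i. s $ i = c" "c > 0"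
    and M: "prob_space M" "white_noise M \<sigma> \<xi>"
    and R: "iid_normal_matrix M v R" "v > 0" and card: "CARD('k) \<le> CARD('r)"
  shows "(LINT \<omega>|M. excess_risk M \<xi> f X (R \<omega>))
    = (c\<^sup>2 * (norm (alpha_star V X f))\<^sup>2 * (1 - real CARD('k) / real CARD('r)) + \<sigma>\<^sup>2 * real CARD('k)) / real CARD('n)"
  by (rule flat_svd_mean_excess_risk[OF svd M borel_measurable_iid_normal_matrix[OF M(1) R(1)]
        gaussian_mean_norm_col_proj_coisometry[OF M(1) R flat_svd_isometry(2)[OF svd] card]])

text \<open>The type \<open>'r\<close> indexes the singular values, so it has d elements in (i) and
  n elements in (ii). In (ii) the vector \<open>f\<close> is fixed before the design is chosen. For
  \<open>f = 0\<close> the vector \<open>alpha_star\<close> vanishes and both risks agree, hence the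
  condition on the strict inequality.\<close>

theorem proposition3:
  fixes M :: "'w measure" and \<xi> :: "'w \<Rightarrow> real^'n" and f :: "real^'n" and \<sigma> :: real
    and R S :: "'w \<Rightarrow> real^'k^'d"
  assumes "prob_space M"
    and "CARD('k) < min CARD('d) CARD('n)"
    and "CARD('r::{finite,linorder}) = min CARD('d) CARD('n)"
    and "white_noise M \<sigma> \<xi>"
    and "iid_normal_matrix M (1 / real CARD('k)) R"
    and "uniform_column_sampling M S"
    and "indep_rv M R \<xi>"
    and "indep_rv M S \<xi>"
  shows
    "(CARD('d) \<le> CARD('n) \<longrightarrow>
       (\<forall>(X :: real^'d^'n) (U :: real^('r::{finite,linorder})^'n) s V.
          thin_svd X U s V \<and> (\<forall>i. s $ i = sqrt (real CARD('n))) \<longrightarrow>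
          (LINT \<omega>|M. excess_risk M \<xi> f X (R \<omega>)) = (LINT \<omega>|M. excess_risk M \<xi> f X (S \<omega>)) \<and>
          (LINT \<omega>|M. excess_risk M \<xi> f X (S \<omega>)) =
            (1 - real CARD('k) / real CARD('d)) * (norm (alpha_star V X f))\<^sup>2
            + real CARD('k) / real CARD('n) * \<sigma>\<^sup>2))
     \<and> (CARD('n) < CARD('d) \<longrightarrow>
       (\<exists>(X :: real^'d^'n) (U :: real^('r::{finite,linorder})^'n) s V.
          thin_svd X U s V \<and> (\<forall>i. s $ i = sqrt (real CARD('d))) \<and>
          (LINT \<omega>|M. excess_risk M \<xi> f X (R \<omega>)) =
            (norm (alpha_star V X f))\<^sup>2 * (real CARD('d) / real CARD('n))
              * (1 - real CARD('k) / real CARD('n))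
            + real CARD('k) / real CARD('n) * \<sigma>\<^sup>2 \<and>
          (LINT \<omega>|M. excess_risk M \<xi> f X (S \<omega>)) =
            (norm (alpha_star V X f))\<^sup>2 * (real CARD('d) / real CARD('n))
              * (1 - real CARD('k) / real CARD('d))
            + real CARD('k) / real CARD('n) * \<sigma>\<^sup>2 \<and>
          (f \<noteq> 0 \<longrightarrow>
            (LINT \<omega>|M. excess_risk M \<xi> f X (R \<omega>)) < (LINT \<omega>|M. excess_risk M \<xi> f X (S \<omega>)))))
     \<and> (\<forall>X :: 'w \<Rightarrow> real^'d^'n.
          iid_normal_matrix M 1 X \<and> indep_rv M X R \<and> indep_rv M X S \<and>
          indep_rv M (\<lambda>\<omega>. (X \<omega>, R \<omega>)) \<xi> \<and> indep_rv M (\<lambda>\<omega>. (X \<omega>, S \<omega>)) \<xi> \<longrightarrow>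
          (LINT \<omega>|M. excess_risk M \<xi> f (X \<omega>) (R \<omega>)) = (LINT \<omega>|M. excess_risk M \<xi> f (X \<omega>) (S \<omega>)))"
proof (intro conjI impI allI; (elim conjE)?)
  note M = assms(1,4) and R = assms(5) and S = assms(6)
  have v: "1 / real CARD('k) > 0" by simp
  have kr: "CARD('k) < CARD('r)" and kd: "CARD('k) \<le> CARD('d)" and kn: "CARD('k) \<le> CARD('n)"
    using assms(2,3) by auto
  have S_meas: "S \<in> borel_measurable M" using assms(8) by (simp add: indep_rv_def)
  have AE_S: "AE \<omega> in M. \<exists>h. inj h \<and> S \<omega> = sampling_matrix h"
    by (rule AE_uniform_column_sampling[OF M(1) S kd])
  {
    fix X :: "real^'d^'n" and U :: "real^('r::{finite,linorder})^'n" and s V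
    assume dn: "CARD('d) \<le> CARD('n)" and svd: "thin_svd X U s V"
      and s: "\<forall>i. s $ i = sqrt (real CARD('n))"
    let ?c = "sqrt (real CARD('n))"
    have svd: "thin_svd X U s V" "\<And>i. s $ i = ?c" "?c > 0" using svd s by auto
    have rd: "CARD('r) = CARD('d)" using assms(3) dn by simp
    note VtV = flat_svd_isometry(2)[OF svd]
    \<comment> \<open>With d singular values \<open>V\<close> is square, so V^T is an isometry as
      well and projecting onto V^T S is a rotated coordinate projection.\<close>
    have VVt: "transpose (transpose V) ** transpose V = mat 1"
      using isometry_transpose_square[OF VtV rd] by simp
    have inj_VS: "inj ((*v) (transpose V ** sampling_matrix h))" if "inj h" for h :: "'k \<Rightarrow> 'd"
      by (intro inj_matrix_mult inj_matrix_isometry[OF VVt] inj_sampling_matrix that)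
    have AE_VS: "AE \<omega> in M. inj ((*v) (transpose V ** S \<omega>))"
      using AE_S by (rule eventually_mono) (metis inj_VS)
    have mean_proj: "(LINT \<omega>|M. (norm (col_proj (transpose V ** S \<omega>) u))\<^sup>2)
        = real CARD('k) / real CARD('d) * (norm u)\<^sup>2" for u
    proof -
      have "(LINT \<omega>|M. (norm (col_proj (transpose V ** S \<omega>) u))\<^sup>2)
          = real CARD('k) / real CARD('d) * (\<Sum>i\<in>UNIV. ((V *v u) $ i)\<^sup>2)"
        by (rule mean_uniform_column_sampling_range[OF M(1) S kd])
          (simp only: col_proj_isometry_mult[OF VVt] matrix_isometry_norm[OF VVt] transpose_transpose
            norm_col_proj_sampling_matrix)
      also have "(\<Sum>i\<in>UNIV. ((V *v u) $ i)\<^sup>2) = (norm (V *v u))\<^sup>2"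
        unfolding power2_norm_eq_inner by (simp add: inner_vec_def power2_eq_square)
      finally show ?thesis by (simp only: matrix_isometry_norm[OF VtV])
    qed
    have mean_S: "(LINT \<omega>|M. excess_risk M \<xi> f X (S \<omega>))
      = (?c\<^sup>2 * (norm (alpha_star V X f))\<^sup>2 * (1 - real CARD('k) / real CARD('d)) + \<sigma>\<^sup>2 * real CARD('k)) / real CARD('n)"
      by (rule flat_svd_mean_excess_risk[OF svd M S_meas AE_VS mean_proj])
    then show "(LINT \<omega>|M. excess_risk M \<xi> f X (R \<omega>)) = (LINT \<omega>|M. excess_risk M \<xi> f X (S \<omega>))"
      using flat_svd_mean_excess_risk_gaussian[OF svd M R v less_imp_le[OF kr]] by (simp only: rd)
    show "(LINT \<omega>|M. excess_risk M \<xi> f X (S \<omega>)) =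
        (1 - real CARD('k) / real CARD('d)) * (norm (alpha_star V X f))\<^sup>2
        + real CARD('k) / real CARD('n) * \<sigma>\<^sup>2"
      unfolding mean_S by (simp add: field_simps)
  }
  {
    assume nd: "CARD('n) < CARD('d)"
    have rn: "CARD('r) = CARD('n)" using assms(3) nd by simp
    \<comment> \<open>Arbitrary indices: \<open>d0\<close> is the column of the design that will
      carry \<open>f\<close>, and \<open>r0\<close> the only coordinate in which
      \<open>alpha_star\<close> may be nonzero.\<close>
    obtain d0 :: 'd and r0 :: 'r where True by simp
    let ?c = "sqrt (real CARD('d))"
    obtain V :: "real^('r::{finite,linorder})^'d" where V: "transpose V ** V = mat 1" "V *v axis r0 1 = axis d0 1"
      "\<And>h :: 'k \<Rightarrow> 'd. inj h \<Longrightarrow> inj ((*v) (transpose V ** sampling_matrix h))"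
      using exists_full_spark_isometry[where 'k='k and 'r='r and 'd='d, of r0 d0] kr rn nd
      by (metis less_imp_le)
    \<comment> \<open>The direction of \<open>f\<close>, with an arbitrary unit vector in its place
      if \<open>f\<close> vanishes.\<close>
    define g where "g = (if f = 0 then axis undefined 1 else f /\<^sub>R norm f)"
    have g: "norm g = 1" "f = norm f *\<^sub>R g" by (auto simp: g_def)
    obtain U :: "real^('r::{finite,linorder})^'n" where U: "transpose U ** U = mat 1" "U *v axis r0 1 = g"
      using exists_isometry_onto_subspace[OF subspace_UNIV _ UNIV_I g(1), where 'r='r and i=r0] rn
      by (metis dim_UNIV DIM_cart DIM_real mult.right_neutral)
    define s :: "real^('r::{finite,linorder})" where "s = (\<chi> i. ?c)"
    have s_nth: "s $ i = ?c" for i by (simp add: s_def)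
    define X where "X = U ** (\<chi> i j. if i = j then s $ i else 0) ** transpose V"
    have svd: "thin_svd X U s V" "\<And>i. s $ i = ?c" "?c > 0"
      by (simp_all add: thin_svd_def U V X_def s_nth)
    let ?\<alpha> = "alpha_star V X f"
    have \<alpha>: "?c *\<^sub>R ?\<alpha> = norm f *\<^sub>R axis r0 1"
    proof -
      have "U *v (norm f *\<^sub>R axis r0 1) = f"
        unfolding matrix_vector_mult_scaleR U(2) by (rule g(2)[symmetric])
      then show ?thesis
        using flat_svd_alpha_star[OF svd] transpose_isometry_mult[OF U(1)] by metis
    qed
    have mean_proj: "(LINT \<omega>|M. (norm (col_proj (transpose V ** S \<omega>) (t *\<^sub>R axis r0 1)))\<^sup>2)
        = real CARD('k) / real CARD('d) * t\<^sup>2" for t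
    proof -
      have "(norm (col_proj (transpose V ** sampling_matrix h) (t *\<^sub>R axis r0 1)))\<^sup>2
          = (\<Sum>i\<in>UNIV. of_bool (i \<in> range h) * (if i = d0 then t\<^sup>2 else 0))" if h: "inj h" for h :: "'k \<Rightarrow> 'd"
      \<comment> \<open>If \<open>d0\<close> is sampled, the axis \<open>r0\<close> is itself a
        column of V^T S and is kept entirely. Otherwise V sends that axis to the axis
        \<open>d0\<close>, which is orthogonal to everything sampled, and nothing is kept.\<close>
      proof (cases "d0 \<in> range h")
        case True
        then obtain j where j: "h j = d0" by blast
        have "sampling_matrix h *v axis j 1 = axis d0 1"
          unfolding matrix_vector_mult_basis
          using j by (simp add: column_def sampling_matrix_nth vec_eq_iff axis_def)
        then have "t *\<^sub>R axis r0 1 = (transpose V ** sampling_matrix h) *v (t *\<^sub>R axis j 1)"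
          by (simp only: matrix_vector_mult_scaleR matrix_vector_mul_assoc[symmetric] V(2)[symmetric]
              transpose_isometry_mult[OF V(1)])
        then have "col_proj (transpose V ** sampling_matrix h) (t *\<^sub>R axis r0 1) = t *\<^sub>R axis r0 1"
          by (simp only: col_proj_mult)
        then show ?thesis using True by (simp add: if_distrib[of "(*) _"] cong: if_cong)
      next
        case False
        have "col_proj (transpose V ** sampling_matrix h) (t *\<^sub>R axis r0 1) = 0"
        proof (rule col_proj_eqI)
          show "0 \<in> range ((*v) (transpose V ** sampling_matrix h))"
            by (rule range_eqI[of _ _ 0]) simp
          fix w
          have "axis r0 1 \<bullet> ((transpose V ** sampling_matrix h) *v w)
              = (V *v axis r0 1) \<bullet> (sampling_matrix h *v w)"
            unfolding matrix_vector_mul_assoc[symmetric] inner_matrix_transpose[of _ "transpose V"]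
              transpose_transpose ..
          also have "\<dots> = 0"
            by (simp add: V(2) inner_axis' sampling_matrix_mult_vec_eq_0[OF False])
          finally show "(t *\<^sub>R axis r0 1 - 0) \<bullet> ((transpose V ** sampling_matrix h) *v w) = 0"
            by simp
        qed
        then show ?thesis using False by (simp add: if_distrib[of "(*) _"] cong: if_cong)
      qed
      from mean_uniform_column_sampling_range[OF M(1) S kd this] show ?thesis by simp
    qed
    have "AE \<omega> in M. inj ((*v) (transpose V ** S \<omega>))"
      using AE_S by (rule eventually_mono) (auto intro: V(3))
    then have "(LINT \<omega>|M. excess_risk M \<xi> f X (S \<omega>))
      = (?c\<^sup>2 * (norm ?\<alpha>)\<^sup>2 * (1 - real CARD('k) / real CARD('d)) + \<sigma>\<^sup>2 * real CARD('k)) / real CARD('n)"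
      by (intro flat_svd_mean_excess_risk[OF svd M S_meas]) (simp_all add: \<alpha> mean_proj)
    then have mean_S: "(LINT \<omega>|M. excess_risk M \<xi> f X (S \<omega>)) =
        (norm ?\<alpha>)\<^sup>2 * (real CARD('d) / real CARD('n)) * (1 - real CARD('k) / real CARD('d))
        + real CARD('k) / real CARD('n) * \<sigma>\<^sup>2"
      by (simp add: add_divide_distrib mult_ac)
    have mean_R: "(LINT \<omega>|M. excess_risk M \<xi> f X (R \<omega>)) =
        (norm ?\<alpha>)\<^sup>2 * (real CARD('d) / real CARD('n)) * (1 - real CARD('k) / real CARD('n))
        + real CARD('k) / real CARD('n) * \<sigma>\<^sup>2"
      unfolding flat_svd_mean_excess_risk_gaussian[OF svd M R v less_imp_le[OF kr]] rn
      by (simp add: add_divide_distrib mult_ac)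
    have less: "(LINT \<omega>|M. excess_risk M \<xi> f X (R \<omega>)) < (LINT \<omega>|M. excess_risk M \<xi> f X (S \<omega>))"
      if "f \<noteq> 0"
    proof -
      have "?\<alpha> \<noteq> 0" using \<alpha> that by (auto simp: axis_eq_0_iff)
      then have "(norm ?\<alpha>)\<^sup>2 * (real CARD('d) / real CARD('n)) > 0" by simp
      moreover have "1 - real CARD('k) / real CARD('n) < 1 - real CARD('k) / real CARD('d)"
        using nd by (simp add: divide_strict_left_mono)
      ultimately show ?thesis
        unfolding mean_R mean_S by (intro add_strict_right_mono mult_strict_left_mono)
    qed
    show "\<exists>(X :: real^'d^'n) (U :: real^('r::{finite,linorder})^'n) s V.
          thin_svd X U s V \<and> (\<forall>i. s $ i = sqrt (real CARD('d))) \<and>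
          (LINT \<omega>|M. excess_risk M \<xi> f X (R \<omega>)) =
            (norm (alpha_star V X f))\<^sup>2 * (real CARD('d) / real CARD('n))
              * (1 - real CARD('k) / real CARD('n))
            + real CARD('k) / real CARD('n) * \<sigma>\<^sup>2 \<and>
          (LINT \<omega>|M. excess_risk M \<xi> f X (S \<omega>)) =
            (norm (alpha_star V X f))\<^sup>2 * (real CARD('d) / real CARD('n))
              * (1 - real CARD('k) / real CARD('d))
            + real CARD('k) / real CARD('n) * \<sigma>\<^sup>2 \<and>
          (f \<noteq> 0 \<longrightarrow>
            (LINT \<omega>|M. excess_risk M \<xi> f X (R \<omega>)) < (LINT \<omega>|M. excess_risk M \<xi> f X (S \<omega>)))"
      using svd(1,2) mean_R mean_S less by blast
  }
  {
    fix X :: "'w \<Rightarrow> real^'d^'n"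
    assume X: "iid_normal_matrix M 1 X" and indep: "indep_rv M X R" "indep_rv M X S"
    have AE_S_inj: "AE \<omega> in M. inj ((*v) (S \<omega>))"
      using AE_S by (rule eventually_mono) (metis inj_sampling_matrix)
    \<comment> \<open>The isometry is taken to be the identity, so the statement about V^T R becomes
      one about R.\<close>
    have AE_R_inj: "AE \<omega> in M. inj ((*v) (R \<omega>))"
      using gaussian_mean_norm_col_proj_coisometry(1)[OF M(1) R v, of "mat 1"] kd
      by (simp add: transpose_mat)
    show "(LINT \<omega>|M. excess_risk M \<xi> f (X \<omega>) (R \<omega>)) = (LINT \<omega>|M. excess_risk M \<xi> f (X \<omega>) (S \<omega>))"
      unfolding gaussian_design_mean_excess_risk[OF M X indep(1) AE_R_inj kn]
        gaussian_design_mean_excess_risk[OF M X indep(2) AE_S_inj kn] ..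
  }
qed

end
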